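(* Let $\mathcal P$ be a tight non-orientably regular polyhedron of type $\{p,q\}$. Then either there are integers $i,j,a,b$ such that $\Gamma(\mathcal P)$ is the quotient of $[p,q]$ by the relations $\sigma_2^{-1}\sigma_1=\sigma_1^i\rho_1\sigma_2^j$ and $\sigma_2^{-2}\sigma_1=\sigma_1^a\sigma_2^b$, or there are integers $i,j,a,b$ such that $\Gamma(\mathcal P^\delta)$ is the quotient of $[q,p]$ by these relations (here "quotient" means that sending the Coxeter generators $x,y,z$ to $\rho_0,\rho_1,\rho_2$ of the respective polyhedron induces an isomorphism, with $\sigma_1,\sigma_2$ interpreted as $xy,yz$ in the Coxeter group and $\rho_1$ as $y$).
   Context: An (abstract) polyhedron is a partially ordered set whose elements have rank 0 (vertices), 1 (edges) or 2 (faces) such that: every flag (maximal chain) consists of one vertex, one edge and one face; each edge is incident with exactly two vertices and exactly two faces; the vertex–edge graph is connected; and for every vertex $F_0$ the poset $\{G:G>F_0\}$ is isomorphic to the vertex–edge incidence poset of a connected 2-regular graph. $\Phi^i$ denotes the flag differing from flag $\Phi$ only in its rank-$i$ element. Type $\{p,q\}$: faces have $p$ edges, vertices lie on $q$ edges. Regular: the automorphism group $\Gamma$ is transitive on flags; with base flag $\Phi$, $\Gamma=\langle\rho_0,\rho_1,\rho_2\rangle$ with $\rho_i:\Phi\mapsto\Phi^i$; $\sigma_1=\rho_0\rho_1,\sigma_2=\rho_1\rho_2$, $\Gamma^+=\langle\sigma_1,\sigma_2\rangle$; non-orientably regular means $\Gamma^+=\Gamma$. A finite polyhedron of type $\{p,q\}$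 has at least $2pq$ flags, and it is tight if it has exactly $2pq$. The dual $\mathcal P^\delta$ is obtained by reversing the partial order; it is regular of type $\{q,p\}$ and its generators $\rho_0',\rho_1',\rho_2'$ (for the same base flag) are $\rho_2,\rho_1,\rho_0$, so $\sigma_1'=\sigma_2^{-1}$, $\sigma_2'=\sigma_1^{-1}$. The Coxeter group $[p,q]=\langle x,y,z\mid x^2=y^2=z^2=(xy)^p=(yz)^q=(xz)^2=1\rangle$.
   Formalization: A polyhedron is also required to have, for every face, its vertices and edges forming a connected 2-regular graph (dual to the vertex condition); without this the claim fails, e.g. for a type {10,6} example with group S_5 whose faces are two disjoint pentagons. *)

theory Defs
  imports "HOL-Algebra.Coset" "HOL-Algebra.Bij" "HOL-Algebra.Generated_Groups"
begin

section \<open>Graphs and their incidence posets\<close>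

text \<open>Graphs may have parallel edges (a digon is a connected 2-regular graph) but no loops.\<close>

definition graph :: "'v set \<Rightarrow> 'e set \<Rightarrow> ('e \<Rightarrow> 'v set) \<Rightarrow> bool" where
  "graph V E ends \<longleftrightarrow> (\<forall>e\<in>E. ends e \<subseteq> V \<and> card (ends e) = 2)"

definition connected_graph :: "'v set \<Rightarrow> 'e set \<Rightarrow> ('e \<Rightarrow> 'v set) \<Rightarrow> bool" where
  "connected_graph V E ends \<longleftrightarrow> graph V E ends \<and>
     (\<forall>u\<in>V. \<forall>v\<in>V. (u, v) \<in> {(x, y). \<exists>e\<in>E. ends e = {x, y}}\<^sup>*)"

definition two_regular_graph :: "'v set \<Rightarrow> 'e set \<Rightarrow> ('e \<Rightarrow> 'v set) \<Rightarrow> bool" where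
  "two_regular_graph V E ends \<longleftrightarrow> graph V E ends \<and> (\<forall>v\<in>V. card {e\<in>E. v \<in> ends e} = 2)"

definition incidence_order :: "'v set \<Rightarrow> 'e set \<Rightarrow> ('e \<Rightarrow> 'v set) \<Rightarrow> ('v + 'e) rel" where
  "incidence_order V E ends =
     Id_on (V <+> E) \<union> {(Inl v, Inr e) | v e. v \<in> V \<and> e \<in> E \<and> v \<in> ends e}"

definition order_isomorphic :: "'a set \<Rightarrow> 'a rel \<Rightarrow> 'b set \<Rightarrow> 'b rel \<Rightarrow> bool" where
  "order_isomorphic A r B s \<longleftrightarrow>
     (\<exists>f. bij_betw f A B \<and> (\<forall>x\<in>A. \<forall>y\<in>A. (x, y) \<in> r \<longleftrightarrow> (f x, f y) \<in> s))"

text \<open>Taking the vertices and edges of the graph from the type of the poset itself is no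
  restriction, since an isomorphic graph can be built from the elements of \<open>A\<close>.\<close>

definition polygonal :: "'a set \<Rightarrow> 'a rel \<Rightarrow> bool" where
  "polygonal A r \<longleftrightarrow> (\<exists>(V :: 'a set) (E :: 'a set) ends.
     connected_graph V E ends \<and> two_regular_graph V E ends \<and>
     order_isomorphic A r (V <+> E) (incidence_order V E ends))"


section \<open>Polyhedra\<close>

record 'a ranked_poset =
  elems :: "'a set"
  le :: "'a rel"
  rank :: "'a \<Rightarrow> nat"

definition of_rank :: "'a ranked_poset \<Rightarrow> nat \<Rightarrow> 'a set" where
  "of_rank P i = {x \<in> elems P. rank P x = i}"

definition flags :: "'a ranked_poset \<Rightarrow> 'a set set" where
  "flags P = {C \<in> Chains (le P). \<forall>D \<in> Chains (le P). C \<subseteq> D \<longrightarrow> D = C}"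

text \<open>The last clause, that every face is a (possibly infinite) polygon, is the dual of the
  clause on vertices.  It is part of the usual definition of an abstract polyhedron (strong
  connectedness), and is what makes the dual of a polyhedron a polyhedron.\<close>

definition polyhedron :: "'a ranked_poset \<Rightarrow> bool" where
  "polyhedron P \<longleftrightarrow>
     partial_order_on (elems P) (le P) \<and>
     (\<forall>x \<in> elems P. rank P x \<in> {0, 1, 2}) \<and>
     (\<forall>x y. (x, y) \<in> le P \<and> x \<noteq> y \<longrightarrow> rank P x < rank P y) \<and>
     (\<forall>C \<in> flags P. \<exists>v \<in> of_rank P 0. \<exists>e \<in> of_rank P 1. \<exists>f \<in> of_rank P 2. C = {v, e, f}) \<and>
     (\<forall>e \<in> of_rank P 1. card {v \<in> of_rank P 0. (v, e) \<in> le P} = 2 \<and>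
                         card {f \<in> of_rank P 2. (e, f) \<in> le P} = 2) \<and>
     connected_graph (of_rank P 0) (of_rank P 1) (\<lambda>e. {v \<in> of_rank P 0. (v, e) \<in> le P}) \<and>
     (\<forall>v \<in> of_rank P 0. polygonal {x. (v, x) \<in> le P \<and> x \<noteq> v} (le P)) \<and>
     (\<forall>f \<in> of_rank P 2. polygonal {x. (x, f) \<in> le P \<and> x \<noteq> f} (le P))"

definition has_type :: "'a ranked_poset \<Rightarrow> nat \<Rightarrow> nat \<Rightarrow> bool" where
  "has_type P p q \<longleftrightarrow>
     (\<forall>f \<in> of_rank P 2. card {e \<in> of_rank P 1. (e, f) \<in> le P} = p) \<and>
     (\<forall>v \<in> of_rank P 0. card {e \<in> of_rank P 1. (v, e) \<in> le P} = q)"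

definition tight :: "'a ranked_poset \<Rightarrow> nat \<Rightarrow> nat \<Rightarrow> bool" where
  "tight P p q \<longleftrightarrow> finite (elems P) \<and> card (flags P) = 2 * p * q"

definition dual :: "'a ranked_poset \<Rightarrow> 'a ranked_poset" where
  "dual P = \<lparr>elems = elems P, le = (le P)\<inverse>, rank = (\<lambda>x. 2 - rank P x)\<rparr>"


section \<open>Automorphisms and regularity\<close>

definition automorphism_group :: "'a ranked_poset \<Rightarrow> ('a \<Rightarrow> 'a) monoid" where
  "automorphism_group P = BijGroup (elems P)
     \<lparr>carrier := {g \<in> Bij (elems P).
        \<forall>x \<in> elems P. \<forall>y \<in> elems P. (x, y) \<in> le P \<longleftrightarrow> (g x, g y) \<in> le P}\<rparr>"

definition regular :: "'a ranked_poset \<Rightarrow> bool" where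
  "regular P \<longleftrightarrow>
     (\<forall>\<Phi> \<in> flags P. \<forall>\<Psi> \<in> flags P. \<exists>g \<in> carrier (automorphism_group P). g ` \<Phi> = \<Psi>)"

definition adjacent_flag :: "'a ranked_poset \<Rightarrow> 'a set \<Rightarrow> nat \<Rightarrow> 'a set" where
  "adjacent_flag P \<Phi> i = (THE \<Psi>. \<Psi> \<in> flags P \<and> \<Psi> \<noteq> \<Phi> \<and>
     {x \<in> \<Psi>. rank P x \<noteq> i} = {x \<in> \<Phi>. rank P x \<noteq> i})"

definition rho :: "'a ranked_poset \<Rightarrow> 'a set \<Rightarrow> nat \<Rightarrow> ('a \<Rightarrow> 'a)" where
  "rho P \<Phi> i = (THE g. g \<in> carrier (automorphism_group P) \<and> g ` \<Phi> = adjacent_flag P \<Phi> i)"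

text \<open>Products are composites in the sense of \<^const>\<open>BijGroup\<close>.  Reading them in the opposite
  order replaces the value of each word in the involutions \<open>\<rho>\<^sub>0, \<rho>\<^sub>1, \<rho>\<^sub>2\<close> by its inverse,
  so it affects neither the rotation subgroup nor which relations hold.\<close>

definition sigma1 :: "'a ranked_poset \<Rightarrow> 'a set \<Rightarrow> ('a \<Rightarrow> 'a)" where
  "sigma1 P \<Phi> = rho P \<Phi> 0 \<otimes>\<^bsub>automorphism_group P\<^esub> rho P \<Phi> 1"

definition sigma2 :: "'a ranked_poset \<Rightarrow> 'a set \<Rightarrow> ('a \<Rightarrow> 'a)" where
  "sigma2 P \<Phi> = rho P \<Phi> 1 \<otimes>\<^bsub>automorphism_group P\<^esub> rho P \<Phi> 2"

definition non_orientably_regular :: "'a ranked_poset \<Rightarrow> 'a set \<Rightarrow> bool" where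
  "non_orientably_regular P \<Phi> \<longleftrightarrow> regular P \<and>
     generate (automorphism_group P) {sigma1 P \<Phi>, sigma2 P \<Phi>} = carrier (automorphism_group P)"


section \<open>Group presentations and Coxeter groups\<close>

text \<open>The letter \<open>(g, True)\<close> stands for the generator \<open>g\<close> and \<open>(g, False)\<close> for its inverse.\<close>

type_synonym 'g word = "('g \<times> bool) list"

inductive word_eq :: "'g word set \<Rightarrow> 'g word \<Rightarrow> 'g word \<Rightarrow> bool" for R where
  refl: "word_eq R w w"
| sym: "word_eq R v w \<Longrightarrow> word_eq R w v"
| trans: "word_eq R u v \<Longrightarrow> word_eq R v w \<Longrightarrow> word_eq R u w"
| cancel: "word_eq R (u @ [(g, b), (g, \<not> b)] @ v) (u @ v)"
| relator: "r \<in> R \<Longrightarrow> word_eq R (u @ r @ v) (u @ v)"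

definition word_class :: "'g word set \<Rightarrow> 'g word \<Rightarrow> 'g word set" where
  "word_class R w = {v. word_eq R w v}"

definition presented_group :: "'g word set \<Rightarrow> 'g word set monoid" where
  "presented_group R =
     \<lparr>carrier = range (word_class R),
      mult = (\<lambda>A B. {w. \<exists>a\<in>A. \<exists>b\<in>B. word_eq R (a @ b) w}),
      one = word_class R []\<rparr>"

lemma word_eq_append_left: "word_eq R a b \<Longrightarrow> word_eq R (c @ a) (c @ b)"
proof (induction rule: word_eq.induct)
  case (refl w)
  show ?case by (rule word_eq.refl)
next
  case (sym v w)
  show ?case by (rule word_eq.sym) (rule sym.IH)
next
  case (trans u v w)
  show ?case by (rule word_eq.trans) (rule trans.IH)+
next
  case (cancel u g b v)
  show ?case using word_eq.cancel[of R "c @ u" g b v] by simp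
next
  case (relator r u v)
  then show ?case using word_eq.relator[of r R "c @ u" v] by simp
qed

lemma word_eq_append_right: "word_eq R a b \<Longrightarrow> word_eq R (a @ c) (b @ c)"
proof (induction rule: word_eq.induct)
  case (refl w)
  show ?case by (rule word_eq.refl)
next
  case (sym v w)
  show ?case by (rule word_eq.sym) (rule sym.IH)
next
  case (trans u v w)
  show ?case by (rule word_eq.trans) (rule trans.IH)+
next
  case (cancel u g b v)
  show ?case using word_eq.cancel[of R u g b "v @ c"] by simp
next
  case (relator r u v)
  then show ?case using word_eq.relator[of r R u "v @ c"] by simp
qed

lemma word_eq_append: "word_eq R a b \<Longrightarrow> word_eq R c d \<Longrightarrow> word_eq R (a @ c) (b @ d)"
  by (rule word_eq.trans, rule word_eq_append_right, assumption, rule word_eq_append_left)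

lemma word_class_eq_iff: "word_class R v = word_class R w \<longleftrightarrow> word_eq R v w"
  unfolding word_class_def set_eq_iff mem_Collect_eq
  using word_eq.refl[of R] word_eq.sym[of R] word_eq.trans[of R] by metis

lemma presented_group_mult:
  "word_class R u \<otimes>\<^bsub>presented_group R\<^esub> word_class R v = word_class R (u @ v)"
proof -
  have "(\<exists>a b. word_eq R u a \<and> word_eq R v b \<and> word_eq R (a @ b) w) \<longleftrightarrow> word_eq R (u @ v) w" for w
    using word_eq.refl[of R] word_eq.trans[of R] word_eq_append[of R] by metis
  then show ?thesis
    by (simp add: presented_group_def word_class_def Bex_def)
qed

lemma group_presented_group: "group (presented_group R)"
proof (rule groupI)
  have carrier: "carrier (presented_group R) = range (word_class R)"
    and one: "\<one>\<^bsub>presented_group R\<^esub> = word_class R []"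
    by (simp_all add: presented_group_def)
  show "x \<otimes>\<^bsub>presented_group R\<^esub> y \<in> carrier (presented_group R)"
    if "x \<in> carrier (presented_group R)" "y \<in> carrier (presented_group R)" for x y
    using that by (auto simp: carrier presented_group_mult)
  show "\<one>\<^bsub>presented_group R\<^esub> \<in> carrier (presented_group R)"
    by (simp add: carrier one)
  show "x \<otimes>\<^bsub>presented_group R\<^esub> y \<otimes>\<^bsub>presented_group R\<^esub> z =
      x \<otimes>\<^bsub>presented_group R\<^esub> (y \<otimes>\<^bsub>presented_group R\<^esub> z)"
    if "x \<in> carrier (presented_group R)" "y \<in> carrier (presented_group R)"
      "z \<in> carrier (presented_group R)" for x y z
    using that by (auto simp: carrier presented_group_mult)
  show "\<one>\<^bsub>presented_group R\<^esub> \<otimes>\<^bsub>presented_group R\<^esub> x = x"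
    if "x \<in> carrier (presented_group R)" for x
    using that by (auto simp: carrier one presented_group_mult)
  have "word_eq R (map (\<lambda>(g, b). (g, \<not> b)) (rev w) @ w) []" for w :: "'a word"
  proof (induction w)
    case Nil
    show ?case by (simp add: word_eq.refl)
  next
    case (Cons l w)
    obtain g b where l: "l = (g, b)" by (cases l)
    show ?case
      using word_eq.trans[OF word_eq.cancel[of R "map (\<lambda>(g, b). (g, \<not> b)) (rev w)" g "\<not> b" w] Cons.IH]
      by (simp add: l)
  qed
  then have "\<exists>y. word_class R y \<otimes>\<^bsub>presented_group R\<^esub> word_class R w = \<one>\<^bsub>presented_group R\<^esub>" for w
    by (auto simp: one presented_group_mult word_class_eq_iff)
  then show "\<exists>y\<in>carrier (presented_group R). y \<otimes>\<^bsub>presented_group R\<^esub> x = \<one>\<^bsub>presented_group R\<^esub>"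
    if "x \<in> carrier (presented_group R)" for x
    using that by (auto simp: carrier)
qed

definition normal_closure :: "('a, 'b) monoid_scheme \<Rightarrow> 'a set \<Rightarrow> 'a set" where
  "normal_closure G S = \<Inter>{N. N \<lhd> G \<and> S \<subseteq> N}"

text \<open>A relation \<open>u = v\<close> is represented by the pair \<open>(u, v)\<close>.\<close>

definition quotient_by_relations :: "('a, 'b) monoid_scheme \<Rightarrow> ('a \<times> 'a) set \<Rightarrow> 'a set monoid" where
  "quotient_by_relations G Rel =
     G Mod normal_closure G {u \<otimes>\<^bsub>G\<^esub> inv\<^bsub>G\<^esub> v | u v. (u, v) \<in> Rel}"

definition quotient_class ::
  "('a, 'b) monoid_scheme \<Rightarrow> ('a \<times> 'a) set \<Rightarrow> 'a \<Rightarrow> 'a set" where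
  "quotient_class G Rel g =
     normal_closure G {u \<otimes>\<^bsub>G\<^esub> inv\<^bsub>G\<^esub> v | u v. (u, v) \<in> Rel} #>\<^bsub>G\<^esub> g"

datatype coxeter_gen = Gen_x | Gen_y | Gen_z

definition word_power :: "'g word \<Rightarrow> nat \<Rightarrow> 'g word" where
  "word_power w n = concat (replicate n w)"

definition coxeter_relators :: "nat \<Rightarrow> nat \<Rightarrow> coxeter_gen word set" where
  "coxeter_relators p q =
     (let x = (Gen_x, True); y = (Gen_y, True); z = (Gen_z, True) in
      {word_power [x] 2, word_power [y] 2, word_power [z] 2,
       word_power [x, y] p, word_power [y, z] q, word_power [x, z] 2})"

definition coxeter_group :: "nat \<Rightarrow> nat \<Rightarrow> coxeter_gen word set monoid" where
  "coxeter_group p q = presented_group (coxeter_relators p q)"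

definition coxeter_elt :: "nat \<Rightarrow> nat \<Rightarrow> coxeter_gen \<Rightarrow> coxeter_gen word set" where
  "coxeter_elt p q g = word_class (coxeter_relators p q) [(g, True)]"


section \<open>The quotients in the theorem\<close>

text \<open>The relations \<open>\<sigma>\<^sub>2\<^sup>-\<^sup>1 \<sigma>\<^sub>1 = \<sigma>\<^sub>1\<^sup>i \<rho>\<^sub>1 \<sigma>\<^sub>2\<^sup>j\<close> and \<open>\<sigma>\<^sub>2\<^sup>-\<^sup>2 \<sigma>\<^sub>1 = \<sigma>\<^sub>1\<^sup>a \<sigma>\<^sub>2\<^sup>b\<close>, where
  \<open>\<sigma>\<^sub>1 = x y\<close>, \<open>\<sigma>\<^sub>2 = y z\<close> and \<open>\<rho>\<^sub>1 = y\<close>.\<close>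

definition tight_relations ::
  "nat \<Rightarrow> nat \<Rightarrow> int \<Rightarrow> int \<Rightarrow> int \<Rightarrow> int \<Rightarrow> (coxeter_gen word set \<times> coxeter_gen word set) set" where
  "tight_relations p q i j a b =
     (let W = coxeter_group p q;
          x = coxeter_elt p q Gen_x; y = coxeter_elt p q Gen_y; z = coxeter_elt p q Gen_z;
          s1 = x \<otimes>\<^bsub>W\<^esub> y; s2 = y \<otimes>\<^bsub>W\<^esub> z
      in {(inv\<^bsub>W\<^esub> s2 \<otimes>\<^bsub>W\<^esub> s1, s1 [^]\<^bsub>W\<^esub> i \<otimes>\<^bsub>W\<^esub> y \<otimes>\<^bsub>W\<^esub> s2 [^]\<^bsub>W\<^esub> j),
          (s2 [^]\<^bsub>W\<^esub> (- 2 :: int) \<otimes>\<^bsub>W\<^esub> s1, s1 [^]\<^bsub>W\<^esub> a \<otimes>\<^bsub>W\<^esub> s2 [^]\<^bsub>W\<^esub> b)})"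

text \<open>The automorphism group of \<open>P\<close> is the quotient of \<open>[p, q]\<close> by a set of relations: sending
  \<open>x, y, z\<close> to \<open>\<rho>\<^sub>0, \<rho>\<^sub>1, \<rho>\<^sub>2\<close> induces an isomorphism.\<close>

definition is_coxeter_quotient ::
  "'a ranked_poset \<Rightarrow> 'a set \<Rightarrow> nat \<Rightarrow> nat \<Rightarrow>
   (coxeter_gen word set \<times> coxeter_gen word set) set \<Rightarrow> bool" where
  "is_coxeter_quotient P \<Phi> p q Rel \<longleftrightarrow>
     (\<exists>h \<in> iso (quotient_by_relations (coxeter_group p q) Rel) (automorphism_group P).
        h (quotient_class (coxeter_group p q) Rel (coxeter_elt p q Gen_x)) = rho P \<Phi> 0 \<and>
        h (quotient_class (coxeter_group p q) Rel (coxeter_elt p q Gen_y)) = rho P \<Phi> 1 \<and>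
        h (quotient_class (coxeter_group p q) Rel (coxeter_elt p q Gen_z)) = rho P \<Phi> 2)"

end

theory Submission
  imports Defs "HOL-Algebra.Multiplicative_Group"
begin

text \<open>In a tight polyhedron every vertex lies on every face, so
  \<open>\<Gamma> = \<langle>\<sigma>\<^sub>1\<rangle>\<langle>\<rho>\<^sub>1\<rangle>\<langle>\<sigma>\<^sub>2\<rangle>\<close> with \<open>2pq\<close> elements \<open>\<sigma>\<^sub>1\<^sup>k \<rho>\<^sub>1\<^sup>\<epsilon> \<sigma>\<^sub>2\<^sup>l\<close>.  If \<open>\<sigma>\<^sub>2\<^sup>-\<^sup>1\<sigma>\<^sub>1\<close> were in
  \<open>\<langle>\<sigma>\<^sub>1\<rangle>\<langle>\<sigma>\<^sub>2\<rangle>\<close>, this product would be a proper subgroup containing \<open>\<Gamma>\<^sup>+\<close>; so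
  \<open>\<sigma>\<^sub>2\<^sup>-\<^sup>1\<sigma>\<^sub>1 = \<sigma>\<^sub>1\<^sup>i \<rho>\<^sub>1 \<sigma>\<^sub>2\<^sup>j\<close>, which makes \<open>\<sigma>\<^sub>2\<close> invert \<open>\<sigma>\<^sub>1\<^bsup>i-2\<^esup>\<close>.  If
  \<open>\<sigma>\<^sub>2\<^sup>-\<^sup>2\<sigma>\<^sub>1\<close> is not in \<open>\<langle>\<sigma>\<^sub>1\<rangle>\<langle>\<sigma>\<^sub>2\<rangle>\<close>, then \<open>\<sigma>\<^sub>2\<^sup>-\<^sup>1\<sigma>\<^sub>1\<^sup>2\<close> is, and this is the second relation
  for the dual.  Conversely the two relations imply that \<open>\<sigma>\<^sub>2\<close> inverts \<open>\<sigma>\<^sub>1\<^sup>4\<close>, from which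
  every element of the presented group has the above normal form.  So that group has at most
  \<open>2pq\<close> elements, and its surjection onto \<open>\<Gamma>\<close> is an isomorphism.\<close>

section \<open>Groups generated by three involutions, two of which commute\<close>

text \<open>In the presented group no geometry is available: the normal form must come from the
  relations alone, and the only general rule for moving \<open>\<sigma>\<^sub>2\<close> past
  \<open>\<sigma>\<^sub>1\<close> is that \<open>\<sigma>\<^sub>2\<sigma>\<^sub>1\<close> is an
  involution. The calculations are therefore made for an arbitrary triple of involutions and then
  used in \<Gamma>, in \<Gamma> with the triple reversed (the dual) and in the quotient of the
  Coxeter group. The lever is that an equation
  \<open>Y (- 1) \<otimes> X s = X t \<otimes> (r1 \<otimes> Y u)\<close> exhibits a second
  involution, because \<open>r1 \<otimes> Y u\<close> is one; comparing it with
  \<open>\<sigma>\<^sub>2\<sigma>\<^sub>1\<close> shows that \<open>\<sigma>\<^sub>2\<close> inverts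
  a power of \<open>\<sigma>\<^sub>1\<close>. The two relations yield three such equations, with
  inverted exponents \<open>i - 2\<close>, \<open>a - i - 1\<close> and \<open>1 - i - a\<close>.
  Eliminating \<open>i\<close> leaves \<open>a - 3\<close> and \<open>a + 1\<close>, which differ by
  4 whatever \<open>a\<close> is: this is the origin of the 4.\<close>

lemma (in group) conj_int_pow:
  assumes "g \<in> carrier G" "h \<in> carrier G" "h' \<in> carrier G" and eq: "g \<otimes> h = h' \<otimes> g"
  shows "g \<otimes> h [^] (k::int) = h' [^] k \<otimes> g"
proof -
  have nat: "g \<otimes> h [^] n = h' [^] n \<otimes> g" for n :: nat
  proof (induction n)
    case (Suc n)
    have "g \<otimes> h [^] Suc n = (g \<otimes> h [^] n) \<otimes> h" using assms by (simp add: m_assoc)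
    also have "\<dots> = h' [^] n \<otimes> (g \<otimes> h)" using assms Suc by (simp add: m_assoc)
    also have "\<dots> = h' [^] Suc n \<otimes> g" using assms by (simp add: m_assoc)
    finally show ?case .
  qed (use assms in simp)
  have "g \<otimes> inv (h [^] n) = inv (h' [^] n) \<otimes> g" for n :: nat
  proof -
    have "inv (h' [^] n) \<otimes> (h' [^] n \<otimes> g) \<otimes> inv (h [^] n) =
        inv (h' [^] n) \<otimes> (g \<otimes> h [^] n) \<otimes> inv (h [^] n)"
      by (simp only: nat)
    also have "\<dots> = inv (h' [^] n) \<otimes> g"
      using assms(1-3) by (simp add: m_assoc)
    finally show ?thesis
      using assms(1-3) by (simp add: m_assoc[symmetric])
  qed
  with nat assms(2,3) show ?thesis
    by (cases "0 \<le> k") (simp_all add: int_pow_def2 del: pow_nat)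
qed

text \<open>Nothing forces the involutions to be nontrivial or distinct, so the locale also applies
  to quotients of a Coxeter group whose size is still unknown.\<close>

locale string_triple = group G for G (structure) +
  fixes r0 r1 r2
  assumes r_closed [simp, intro]: "r0 \<in> carrier G" "r1 \<in> carrier G" "r2 \<in> carrier G"
    and r0_invol: "r0 \<otimes> r0 = \<one>" and r1_invol: "r1 \<otimes> r1 = \<one>" and r2_invol: "r2 \<otimes> r2 = \<one>"
    and r0_r2_commute: "r0 \<otimes> r2 = r2 \<otimes> r0"
begin

definition X :: "int \<Rightarrow> 'a" where "X k = (r0 \<otimes> r1) [^] k"
definition Y :: "int \<Rightarrow> 'a" where "Y k = (r1 \<otimes> r2) [^] k"
text \<open>\<open>r1\<close> inverts both rotations, so moving it to either end only changes signs
  of exponents. The two halves may overlap.\<close>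

definition NF :: "'a set" where
  "NF = {X k \<otimes> Y l | k l. True} \<union> {X k \<otimes> (r1 \<otimes> Y l) | k l. True}"

lemma cancel_invol: "r0 \<otimes> (r0 \<otimes> z) = z" "r1 \<otimes> (r1 \<otimes> z) = z" "r2 \<otimes> (r2 \<otimes> z) = z"
  if "z \<in> carrier G"
  using that by (simp_all add: m_assoc[symmetric] r0_invol r1_invol r2_invol)

lemma X_closed [simp, intro]: "X k \<in> carrier G" and Y_closed [simp, intro]: "Y k \<in> carrier G"
  by (simp_all add: X_def Y_def)

lemma X_0 [simp]: "X 0 = \<one>" and Y_0 [simp]: "Y 0 = \<one>"
  by (simp_all add: X_def Y_def)

lemma X_1: "X 1 = r0 \<otimes> r1" and Y_1: "Y 1 = r1 \<otimes> r2"
  by (simp_all add: X_def Y_def)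

lemma X_add: "X k \<otimes> X l = X (k + l)" and Y_add: "Y k \<otimes> Y l = Y (k + l)"
  by (simp_all add: X_def Y_def int_pow_mult)

lemma X_add': "z \<in> carrier G \<Longrightarrow> X k \<otimes> (X l \<otimes> z) = X (k + l) \<otimes> z"
  and Y_add': "z \<in> carrier G \<Longrightarrow> Y k \<otimes> (Y l \<otimes> z) = Y (k + l) \<otimes> z"
  by (simp_all add: m_assoc[symmetric] X_add Y_add)

lemma inv_X [simp]: "inv (X k) = X (- k)" and inv_Y [simp]: "inv (Y k) = Y (- k)"
  by (rule inv_equality; simp add: X_add Y_add)+

lemma inv_r [simp]: "inv r0 = r0" "inv r1 = r1" "inv r2 = r2"
  by (rule inv_equality; simp add: r0_invol r1_invol r2_invol)+

lemma r1_X: "r1 \<otimes> X k = X (- k) \<otimes> r1" and r1_Y: "r1 \<otimes> Y k = Y (- k) \<otimes> r1"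
proof -
  have "r1 \<otimes> (r0 \<otimes> r1) = inv (r0 \<otimes> r1) \<otimes> r1" "r1 \<otimes> (r1 \<otimes> r2) = inv (r1 \<otimes> r2) \<otimes> r1"
    by (simp_all add: inv_mult_group m_assoc cancel_invol r1_invol)
  note eqs = this
  have pow: "inv (r0 \<otimes> r1) [^] k = X (- k)" "inv (r1 \<otimes> r2) [^] k = Y (- k)"
    by (simp_all only: X_def Y_def int_pow_inv int_pow_neg m_closed r_closed)
  show "r1 \<otimes> X k = X (- k) \<otimes> r1"
    unfolding X_def[of k] pow(1)[symmetric] by (rule conj_int_pow[OF _ _ _ eqs(1)]) simp_all
  show "r1 \<otimes> Y k = Y (- k) \<otimes> r1"
    unfolding Y_def[of k] pow(2)[symmetric] by (rule conj_int_pow[OF _ _ _ eqs(2)]) simp_all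
qed

lemma r1_X': "z \<in> carrier G \<Longrightarrow> r1 \<otimes> (X k \<otimes> z) = X (- k) \<otimes> (r1 \<otimes> z)"
  by (simp add: m_assoc[symmetric] r1_X)

lemma Y_r1: "Y k \<otimes> r1 = r1 \<otimes> Y (- k)"
  by (simp add: r1_Y)

lemma Y_r1': "z \<in> carrier G \<Longrightarrow> Y k \<otimes> (r1 \<otimes> z) = r1 \<otimes> (Y (- k) \<otimes> z)"
  by (simp add: m_assoc[symmetric] r1_Y)

text \<open>Oriented so that \<open>r1\<close> travels right past \<open>X\<close> and left past
  \<open>Y\<close>, ending between them. A \<open>Y\<close> in front of an \<open>X\<close> is left
  alone: no general rule covers that exchange. The primed versions act inside right-nested
  products.\<close>

lemmas norm = m_assoc X_add Y_add X_add' Y_add' r1_X r1_X' Y_r1 Y_r1' r1_invol cancel_invol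

text \<open>\<open>Y 1 \<otimes> X 1\<close> is
  \<open>r1 \<otimes> (r2 \<otimes> r0) \<otimes> r1\<close>, a conjugate of a product of commuting
  involutions, so it equals its own inverse.\<close>

lemma Y1_X1: "Y 1 \<otimes> X 1 = X (- 1) \<otimes> Y (- 1)"
proof -
  have "X (- 1) = inv (r0 \<otimes> r1)" "Y (- 1) = inv (r1 \<otimes> r2)"
    by (metis X_1 inv_X, metis Y_1 inv_Y)
  then have *: "X (- 1) = r1 \<otimes> r0" "Y (- 1) = r2 \<otimes> r1"
    by (simp_all add: inv_mult_group)
  have "Y 1 \<otimes> X 1 = r1 \<otimes> (r2 \<otimes> r0) \<otimes> r1" by (simp add: X_1 Y_1 m_assoc)
  also have "\<dots> = r1 \<otimes> (r0 \<otimes> r2) \<otimes> r1" by (simp only: r0_r2_commute)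
  finally show ?thesis by (simp add: * m_assoc)
qed

lemma swap: "string_triple G r2 r1 r0"
  by unfold_locales (simp_all add: r0_invol r1_invol r2_invol r0_r2_commute)

text \<open>Reversing the triple replaces \<open>r0 \<otimes> r1\<close> by
  \<open>r2 \<otimes> r1\<close>, the inverse of \<open>r1 \<otimes> r2\<close>; hence the minus
  signs.\<close>

lemma X_swap: "string_triple.X G r2 r1 k = Y (- k)" and Y_swap: "string_triple.Y G r1 r0 k = X (- k)"
proof -
  have "inv (r1 \<otimes> r2) = r2 \<otimes> r1" "inv (r0 \<otimes> r1) = r1 \<otimes> r0"
    by (simp_all add: inv_mult_group)
  then show "string_triple.X G r2 r1 k = Y (- k)" "string_triple.Y G r1 r0 k = X (- k)"
    unfolding string_triple.X_def[OF swap] string_triple.Y_def[OF swap] X_def Y_def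
    by (metis int_pow_inv int_pow_neg m_closed r_closed)+
qed

section \<open>Powers of one rotation inverted by the other\<close>

definition inverted :: "int \<Rightarrow> bool" where
  "inverted k \<longleftrightarrow> Y 1 \<otimes> X k = X (- k) \<otimes> Y 1"

text \<open>Together with \<open>inverted_add\<close>: the exponents \<open>k\<close> for which
  conjugation by \<open>Y 1\<close> inverts \<open>X k\<close> form an additive subgroup of the
  integers, so exponents found separately may be added and subtracted.\<close>

lemma inverted_minus:
  assumes "inverted k" shows "inverted (- k)"
proof -
  have "Y 1 \<otimes> X (- k) = X k \<otimes> (X (- k) \<otimes> Y 1) \<otimes> X (- k)" by (simp add: norm)
  also have "\<dots> = X k \<otimes> (Y 1 \<otimes> X k) \<otimes> X (- k)" using assms by (simp add: inverted_def)
  finally show ?thesis by (simp add: inverted_def norm)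
qed

lemma inverted_add:
  assumes "inverted k" "inverted l" shows "inverted (k + l)"
proof -
  have "Y 1 \<otimes> X (k + l) = (Y 1 \<otimes> X k) \<otimes> X l" by (simp add: norm)
  also have "\<dots> = X (- k) \<otimes> (Y 1 \<otimes> X l)" using assms by (simp add: inverted_def m_assoc)
  finally show ?thesis using assms by (simp add: inverted_def norm add.commute)
qed

lemma Y1_eq: "Y 1 = X (- 1) \<otimes> (Y (- 1) \<otimes> X (- 1))"
proof -
  have "Y 1 = (Y 1 \<otimes> X 1) \<otimes> X (- 1)" by (simp add: norm)
  then show ?thesis by (simp only: Y1_X1) (simp add: norm)
qed

lemma X1_Y1_eq: "X 1 \<otimes> Y 1 = Y (- 1) \<otimes> X (- 1)"
  by (subst Y1_eq) (simp add: norm)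

text \<open>The relation says that \<open>Y (- 1) \<otimes> X (s - t)\<close> is conjugate to the involution \<open>r1 \<otimes> Y u\<close>.
  So \<open>Y 1 \<otimes> X (t - s)\<close> is an involution, as is \<open>Y 1 \<otimes> X 1\<close>, and conjugation by \<open>Y 1\<close> inverts the
  quotient of \<open>X (t - s)\<close> and \<open>X 1\<close>.\<close>

lemma inverted_of_relation:
  assumes "Y (- 1) \<otimes> X s = X t \<otimes> (r1 \<otimes> Y u)"
  shows "inverted (t - s - 1)"
proof -
  have "X (- t) \<otimes> (Y (- 1) \<otimes> X s) = r1 \<otimes> Y u" using assms by (simp add: norm)
  moreover have "inv (X (- t) \<otimes> (Y (- 1) \<otimes> X s)) = inv (r1 \<otimes> Y u)" using calculation by simp
  then have "X (- s) \<otimes> (Y 1 \<otimes> X t) = r1 \<otimes> Y u" by (simp add: inv_mult_group norm)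
  ultimately have "X s \<otimes> (X (- t) \<otimes> (Y (- 1) \<otimes> X s)) \<otimes> X (- s) =
      X s \<otimes> (X (- s) \<otimes> (Y 1 \<otimes> X t)) \<otimes> X (- s)" by simp
  then have *: "Y 1 \<otimes> X (t - s) = X (s - t) \<otimes> Y (- 1)" by (simp add: norm)
  have "Y 1 \<otimes> X (t - s - 1) = Y 1 \<otimes> X (t - s) \<otimes> X (- 1)" by (simp add: norm)
  also have "\<dots> = X (s - t) \<otimes> (Y (- 1) \<otimes> X (- 1))" by (simp only: *) (simp add: norm)
  also have "\<dots> = X (s - t) \<otimes> (X 1 \<otimes> Y 1)" by (simp only: X1_Y1_eq)
  finally show ?thesis by (simp add: inverted_def norm algebra_simps)
qed

text \<open>The hypothesis makes \<open>Y s \<otimes> X 1 \<otimes> Y (- u)\<close> equal to the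
  involution \<open>X t \<otimes> r1\<close>. A conjugate of it is
  \<open>X 1 \<otimes> Y (s - u)\<close>; comparison with the involution
  \<open>X (- 1) \<otimes> Y (- 1)\<close> gives the inversion.\<close>

lemma inverts_Y_of_relation:
  assumes "Y s \<otimes> X 1 = X t \<otimes> (r1 \<otimes> Y u)"
  shows "X 1 \<otimes> Y (s - u - 1) = Y (u - s + 1) \<otimes> X 1"
proof -
  have "Y s \<otimes> X 1 \<otimes> Y (- u) = X t \<otimes> r1" using assms by (simp add: norm)
  moreover have "inv (Y s \<otimes> X 1 \<otimes> Y (- u)) = inv (X t \<otimes> r1)" using calculation by simp
  then have "Y u \<otimes> (X (- 1) \<otimes> Y (- s)) = X t \<otimes> r1" by (simp add: inv_mult_group norm)
  ultimately have "Y (- s) \<otimes> (Y s \<otimes> X 1 \<otimes> Y (- u)) \<otimes> Y s =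
      Y (- s) \<otimes> (Y u \<otimes> (X (- 1) \<otimes> Y (- s))) \<otimes> Y s" by simp
  then have *: "X 1 \<otimes> Y (s - u) = Y (u - s) \<otimes> X (- 1)" by (simp add: norm)
  have **: "X (- 1) \<otimes> Y (- 1) = Y 1 \<otimes> X 1" by (simp add: Y1_X1)
  have "X 1 \<otimes> Y (s - u - 1) = X 1 \<otimes> Y (s - u) \<otimes> Y (- 1)" by (simp add: norm)
  also have "\<dots> = Y (u - s) \<otimes> (X (- 1) \<otimes> Y (- 1))" by (simp only: *) (simp add: norm)
  also have "\<dots> = Y (u - s) \<otimes> (Y 1 \<otimes> X 1)" by (simp only: **)
  finally show ?thesis by (simp add: norm algebra_simps)
qed

text \<open>Conjugation by \<open>r1\<close> fixes \<open>r1\<close> and negates every exponent.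
  \<open>conj_relation0\<close> is the same for relations without the factor
  \<open>r1\<close>.\<close>

lemma conj_relation:
  assumes "Y s \<otimes> X k = X t \<otimes> (r1 \<otimes> Y u)"
  shows "Y (- s) \<otimes> X (- k) = X (- t) \<otimes> (r1 \<otimes> Y (- u))"
proof -
  have "r1 \<otimes> (Y s \<otimes> X k) \<otimes> r1 = r1 \<otimes> (X t \<otimes> (r1 \<otimes> Y u)) \<otimes> r1" using assms by simp
  moreover have "r1 \<otimes> (Y s \<otimes> X k) = Y (- s) \<otimes> (X (- k) \<otimes> r1)"
    by (metis X_closed Y_closed m_assoc r1_X r1_Y r_closed(2))
  ultimately show ?thesis by (simp add: norm)
qed

lemma conj_relation0:
  assumes "Y s \<otimes> X k = X t \<otimes> Y u"
  shows "Y (- s) \<otimes> X (- k) = X (- t) \<otimes> Y (- u)"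
proof -
  have "r1 \<otimes> (Y s \<otimes> X k) \<otimes> r1 = r1 \<otimes> (X t \<otimes> Y u) \<otimes> r1" using assms by simp
  moreover have "r1 \<otimes> (Y s \<otimes> X k) = Y (- s) \<otimes> (X (- k) \<otimes> r1)"
    by (metis X_closed Y_closed m_assoc r1_X r1_Y r_closed(2))
  ultimately show ?thesis by (simp add: norm)
qed

section \<open>Closure properties of the normal forms\<close>

lemma NF_I [intro]: "X k \<otimes> Y l \<in> NF" "X k \<otimes> (r1 \<otimes> Y l) \<in> NF"
  by (auto simp: NF_def)

lemma NF_closed: "NF \<subseteq> carrier G"
  by (auto simp: NF_def)

lemma X_pow: "X k [^] (m::int) = X (k * m)" and Y_pow: "Y k [^] (m::int) = Y (k * m)"
  by (simp_all add: X_def Y_def int_pow_pow)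

lemma NF_E:
  assumes "n \<in> NF"
  obtains k l where "n = X k \<otimes> Y l" | k l where "n = X k \<otimes> (r1 \<otimes> Y l)"
proof -
  have "(\<exists>k l. n = X k \<otimes> Y l) \<or> (\<exists>k l. n = X k \<otimes> (r1 \<otimes> Y l))"
    using assms by (simp add: NF_def)
  then show thesis by (elim disjE exE) (rule that, assumption)+
qed

lemma X_NF: "n \<in> NF \<Longrightarrow> X k \<otimes> n \<in> NF"
  by (auto simp: norm elim!: NF_E)

text \<open>\<open>NF\<close> is closed under left multiplication by \<open>X k\<close> and
  \<open>r1\<close> and under right multiplication by \<open>Y l\<close> and \<open>r1\<close>. As
  \<open>r0\<close> is \<open>X 1 \<otimes> r1\<close> and \<open>r2\<close> is
  \<open>r1 \<otimes> Y 1\<close>, only left multiplication by \<open>Y 1\<close> is in question,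
  and there everything after the leading \<open>X k\<close> can be split off.\<close>

lemma generate_subset_NF:
  assumes Y_X: "\<And>k. Y 1 \<otimes> X k \<in> NF"
  shows "generate G {r0, r1, r2} \<subseteq> NF"
proof -
  have r_NF: "r1 \<otimes> n \<in> NF"
    and NF_Y: "n \<otimes> Y l \<in> NF" and NF_r: "n \<otimes> r1 \<in> NF" if "n \<in> NF" for n k l
    using that by (auto simp: norm elim!: NF_E)
  have Y_NF: "Y 1 \<otimes> n \<in> NF" if "n \<in> NF" for n
  proof -
    from that show ?thesis
    proof (cases rule: NF_E)
      case (1 k l)
      then have "Y 1 \<otimes> n = (Y 1 \<otimes> X k) \<otimes> Y l" by (simp add: m_assoc)
      then show ?thesis using NF_Y[OF Y_X] by simp
    next
      case (2 k l)
      then have "Y 1 \<otimes> n = (Y 1 \<otimes> X k) \<otimes> r1 \<otimes> Y l" by (simp add: m_assoc)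
      then show ?thesis using NF_Y[OF NF_r[OF Y_X]] by simp
    qed
  qed
  have gens: "s \<otimes> n \<in> NF" if "s \<in> {r0, r1, r2}" "n \<in> NF" for s n
  proof -
    have n: "n \<in> carrier G" using that NF_closed by blast
    have "r0 \<otimes> n = X 1 \<otimes> (r1 \<otimes> n)" "r2 \<otimes> n = r1 \<otimes> (Y 1 \<otimes> n)"
      using n by (simp_all only: X_1 Y_1 m_assoc r_closed m_closed cancel_invol)
    then show ?thesis using that X_NF Y_NF r_NF by auto
  qed
  have "g \<otimes> n \<in> NF" if "g \<in> generate G {r0, r1, r2}" "n \<in> NF" for g n
    using that
  proof (induction arbitrary: n rule: generate.induct)
    case one
    then show ?case using NF_closed by auto
  next
    case (incl h)
    then show ?case using gens by auto
  next
    case (inv h)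
    then have "m_inv G h = h" by auto
    then show ?case using gens inv by auto
  next
    case (eng h1 h2)
    have "h1 \<in> carrier G" "h2 \<in> carrier G"
      using eng generate_in_carrier[of "{r0, r1, r2}"] by auto
    then show ?case using eng NF_closed by (simp add: m_assoc subset_iff)
  qed
  from this[OF _ NF_I(1)[of 0 0]] show ?thesis
    using generate_in_carrier[of "{r0, r1, r2}"] by auto
qed

text \<open>Combining the two relations gives two further ones of the shape treated above.  Together
  the three exponents show that \<open>Y 1\<close> inverts \<open>X 4\<close>, so that only four products \<open>Y 1 \<otimes> X t\<close>
  remain to be put in normal form.\<close>

lemma generate_subset_NF_of_relations:
  assumes R1: "Y (- 1) \<otimes> X 1 = X i \<otimes> (r1 \<otimes> Y j)" and R2: "Y (- 2) \<otimes> X 1 = X a \<otimes> Y b"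
  shows "generate G {r0, r1, r2} \<subseteq> NF"
proof -
  have i: "inverted (i - 2)" using inverted_of_relation[OF R1] by simp
  \<comment> \<open>The second relation with the first inserted becomes an equation for
    \<open>Y (- 1) \<otimes> X i\<close> that again contains one \<open>r1\<close>.\<close>
  have "Y (- 1) \<otimes> (Y (- 1) \<otimes> X 1) = X a \<otimes> Y b" using R2 by (simp add: norm)
  then have "Y (- 1) \<otimes> (X i \<otimes> (r1 \<otimes> Y j)) \<otimes> Y (- j) \<otimes> r1 = X a \<otimes> Y b \<otimes> Y (- j) \<otimes> r1"
    by (simp only: R1)
  then have "Y (- 1) \<otimes> X i = X a \<otimes> (r1 \<otimes> Y (j - b))" by (simp add: norm)
  from inverted_of_relation[OF this] have ai: "inverted (a - i - 1)" .
  have "inverted (a - 3)" using inverted_add[OF i ai] by simp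
  have YX2: "Y 1 \<otimes> X 2 = X (i - 1) \<otimes> (r1 \<otimes> Y j)"
  proof -
    have "Y 1 \<otimes> X 2 = (Y 1 \<otimes> X 1) \<otimes> X 1" by (simp add: norm)
    also have "\<dots> = X (- 1) \<otimes> (Y (- 1) \<otimes> X 1)" by (simp only: Y1_X1) (simp add: norm)
    also have "\<dots> = X (- 1) \<otimes> (X i \<otimes> (r1 \<otimes> Y j))" by (simp only: R1)
    finally show ?thesis by (simp add: norm)
  qed
  have R2': "Y 2 = X (- a) \<otimes> (Y (- b) \<otimes> X 1)"
  proof -
    have "Y 2 \<otimes> X (- 1) \<otimes> X 1 = X (- a) \<otimes> Y (- b) \<otimes> X 1" using conj_relation0[OF R2] by simp
    then show ?thesis by (simp add: norm)
  qed
  \<comment> \<open>By the first relation \<open>X 1\<close> inverts \<open>Y (j + 2)\<close>;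
    taking inverses gives the form that moves \<open>Y (j + 2)\<close> past
    \<open>X (- 1)\<close>.\<close>
  have "inv (X 1 \<otimes> Y (- j - 2)) = inv (Y (j + 2) \<otimes> X 1)"
    using inverts_Y_of_relation[OF R1] by (simp add: algebra_simps)
  then have d: "Y (j + 2) \<otimes> X (- 1) = X (- 1) \<otimes> Y (- j - 2)"
    by (simp add: inv_mult_group algebra_simps)
  \<comment> \<open>The third equation with one \<open>r1\<close>: \<open>R2'\<close> trades the
    factor \<open>X (- a)\<close> for \<open>Y 2\<close>, which merges with \<open>Y j\<close> into
    the power that \<open>d\<close> can move.\<close>
  have "Y 1 \<otimes> X (2 - a) = Y 1 \<otimes> X 2 \<otimes> (X (- a) \<otimes> (Y (- b) \<otimes> X 1)) \<otimes> X (- 1) \<otimes> Y b"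
    by (simp add: norm)
  also have "\<dots> = X (i - 1) \<otimes> (r1 \<otimes> Y j) \<otimes> Y 2 \<otimes> X (- 1) \<otimes> Y b" by (simp only: YX2 R2')
  also have "\<dots> = X (i - 1) \<otimes> (r1 \<otimes> (Y (j + 2) \<otimes> X (- 1))) \<otimes> Y b" by (simp add: norm)
  also have "\<dots> = X (i - 1) \<otimes> (r1 \<otimes> (X (- 1) \<otimes> Y (- j - 2))) \<otimes> Y b" by (simp only: d)
  also have "\<dots> = X i \<otimes> (r1 \<otimes> Y (b - j - 2))" by (simp add: norm algebra_simps)
  finally have "Y (- 1) \<otimes> X (a - 2) = X (- i) \<otimes> (r1 \<otimes> Y (j + 2 - b))"
    using conj_relation[of 1 "2 - a" i "b - j - 2"] by (simp add: algebra_simps)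
  \<comment> \<open>Adding \<open>i - 2\<close> eliminates \<open>i\<close>; the sum is
    \<open>- (a + 1)\<close>.\<close>
  from inverted_of_relation[OF this] have "inverted ((- i - a + 1) + (i - 2))"
    by (intro inverted_add[OF _ i]) (simp add: algebra_simps)
  then have "inverted (a + 1)"
    using inverted_minus[of "(- i - a + 1) + (i - 2)"] by (simp add: algebra_simps)
  then have "inverted ((a + 1) + - (a - 3))"
    using \<open>inverted (a - 3)\<close> by (rule inverted_add[OF _ inverted_minus])
  then have "Y 1 \<otimes> X 4 = X (- 4) \<otimes> Y 1"
    by (simp add: inverted_def)
  then have X4: "Y 1 \<otimes> X (4 * m) = X (- 4 * m) \<otimes> Y 1" for m
    using conj_int_pow[of "Y 1" "X 4" "X (- 4)" m] by (simp add: X_pow)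
  have "Y 1 \<otimes> X k \<in> NF" for k
  proof -
    \<comment> \<open>The shift by one makes the remainder range over -1, 0, 1, 2, the exponents for
      which \<open>Y 1 \<otimes> X t\<close> is at hand: 1 and 2 from \<open>Y1_X1\<close> and
      \<open>YX2\<close>, -1 from the conjugate of \<open>R1\<close>.\<close>
    define m t where "m = (k + 1) div 4" and "t = (k + 1) mod 4 - 1"
    have k: "k = 4 * m + t" using mult_div_mod_eq[of 4 "k + 1"] unfolding m_def t_def by linarith
    have "Y 1 \<otimes> X t \<in> NF"
    proof -
      have "t = 0 \<or> t = 1 \<or> t = 2 \<or> t = - 1" unfolding t_def by presburger
      moreover have "Y 1 \<otimes> X 0 \<in> NF" using NF_I(1)[of 0 1] by simp
      moreover have "Y 1 \<otimes> X 1 \<in> NF" "Y 1 \<otimes> X 2 \<in> NF" by (auto simp: Y1_X1 YX2)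
      moreover have "Y 1 \<otimes> X (- 1) \<in> NF" using conj_relation[OF R1] by auto
      ultimately show ?thesis by auto
    qed
    then have "X (- 4 * m) \<otimes> (Y 1 \<otimes> X t) \<in> NF"
      by (rule X_NF)
    also have "X (- 4 * m) \<otimes> (Y 1 \<otimes> X t) = Y 1 \<otimes> X (4 * m) \<otimes> X t"
      by (simp only: X4) (simp add: m_assoc)
    finally show ?thesis by (simp add: k norm)
  qed
  then show ?thesis by (rule generate_subset_NF)
qed

text \<open>Here \<open>Y (j - 1)\<close> commutes with \<open>X 1\<close>, and \<open>Y 1\<close> conjugates \<open>X 2\<close> to \<open>X (i - 1) \<otimes> Y (j - 1)\<close>.\<close>

lemma generate_rotations:
  assumes R: "Y (- 1) \<otimes> X 1 = X i \<otimes> Y j"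
  shows "generate G {X 1, Y 1} \<subseteq> {X k \<otimes> Y l | k l. True}" (is "_ \<subseteq> ?S")
proof -
  have I: "X k \<otimes> Y l \<in> ?S" for k l by blast
  \<comment> \<open>\<open>X i\<close> is expressed twice: by \<open>R\<close>, and as the inverse
    of the conjugate of \<open>R\<close> by \<open>r1\<close>. Equating the two expressions shows
    that \<open>Y (j - 1)\<close> commutes with \<open>X 1\<close>.\<close>
  have "inv (Y (- 1) \<otimes> X 1 \<otimes> Y (- j)) = X (- i)" "Y (- 1) \<otimes> X 1 \<otimes> Y (- j) = X i"
    using R by (simp_all add: norm)
  moreover have "Y 1 \<otimes> X (- 1) \<otimes> Y j = X (- i)"
    using conj_relation0[OF R] by (simp add: norm)
  then have "inv (Y 1 \<otimes> X (- 1) \<otimes> Y j) = X i" by simp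
  ultimately have "Y (- 1) \<otimes> X 1 \<otimes> Y (- j) = Y (- j) \<otimes> (X 1 \<otimes> Y (- 1))"
    by (simp add: inv_mult_group norm)
  then have "Y j \<otimes> (Y (- 1) \<otimes> X 1 \<otimes> Y (- j)) \<otimes> Y j = Y j \<otimes> (Y (- j) \<otimes> (X 1 \<otimes> Y (- 1))) \<otimes> Y j"
    by simp
  then have "Y (j - 1) \<otimes> X 1 = X 1 \<otimes> Y (j - 1)" by (simp add: norm)
  then have "Y (j - 1) \<otimes> X k = X k \<otimes> Y (j - 1)" for k
    using conj_int_pow[of "Y (j - 1)" "X 1" "X 1" k] by (simp add: X_pow)
  then have d: "X (i - 1) \<otimes> Y (j - 1) = Y (j - 1) \<otimes> X (i - 1)" by simp
  have "Y 1 \<otimes> X 2 = (Y 1 \<otimes> X 1) \<otimes> X 1" by (simp add: norm)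
  also have "\<dots> = X (- 1) \<otimes> (Y (- 1) \<otimes> X 1)" by (simp only: Y1_X1) (simp add: norm)
  also have "\<dots> = X (- 1) \<otimes> (X i \<otimes> Y j)" by (simp only: R)
  finally have "Y 1 \<otimes> X 2 = (X (i - 1) \<otimes> Y (j - 1)) \<otimes> Y 1" by (simp add: norm)
  then have even: "Y 1 \<otimes> X (2 * m) = X ((i - 1) * m) \<otimes> (Y ((j - 1) * m) \<otimes> Y 1)" for m
    using conj_int_pow[of "Y 1" "X 2" "X (i - 1) \<otimes> Y (j - 1)" m]
    by (simp add: X_pow Y_pow int_pow_mult_distrib[OF d] m_assoc)
  have dm: "Y ((j - 1) * m) \<otimes> X k = X k \<otimes> Y ((j - 1) * m)" for m k
    using conj_int_pow[of "X k" "Y (j - 1)" "Y (j - 1)" m]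
      \<open>\<And>k. Y (j - 1) \<otimes> X k = X k \<otimes> Y (j - 1)\<close> by (simp add: Y_pow)
  \<comment> \<open>Even powers are powers of \<open>X 2\<close>, whose conjugate is known. An odd
    power leaves one \<open>X 1\<close>, which \<open>Y1_X1\<close> absorbs; the powers of
    \<open>Y (j - 1)\<close> commute with the resulting \<open>X (- 1)\<close>.\<close>
  have YX: "Y 1 \<otimes> X k \<in> ?S" for k
  proof (cases "even k")
    case True
    then obtain m where "k = 2 * m" by blast
    then have "Y 1 \<otimes> X k = X ((i - 1) * m) \<otimes> Y ((j - 1) * m + 1)"
      by (simp only: even Y_add)
    then show ?thesis by (simp only: I)
  next
    case False
    then obtain m where "k = 2 * m + 1" by (rule oddE)
    then have "Y 1 \<otimes> X k = (Y 1 \<otimes> X (2 * m)) \<otimes> X 1" by (simp add: norm)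
    also have "\<dots> = X ((i - 1) * m) \<otimes> (Y ((j - 1) * m) \<otimes> (Y 1 \<otimes> X 1))"
      by (simp only: even) (simp add: m_assoc)
    also have "\<dots> = X ((i - 1) * m) \<otimes> ((Y ((j - 1) * m) \<otimes> X (- 1)) \<otimes> Y (- 1))"
      by (simp only: Y1_X1) (simp add: m_assoc)
    also have "\<dots> = X ((i - 1) * m - 1) \<otimes> Y ((j - 1) * m - 1)"
      by (simp only: dm) (simp add: norm)
    finally show ?thesis by (simp only: I)
  qed
  have X_S: "X k \<otimes> n \<in> ?S" and S_Y: "n \<otimes> Y k \<in> ?S" and S_conj: "r1 \<otimes> (n \<otimes> r1) \<in> ?S"
    and S_closed: "n \<in> carrier G" if "n \<in> ?S" for n k
  proof -
    from that obtain a b where n: "n = X a \<otimes> Y b" by blast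
    have "X k \<otimes> n = X (k + a) \<otimes> Y b" "n \<otimes> Y k = X a \<otimes> Y (b + k)"
      "r1 \<otimes> (n \<otimes> r1) = X (- a) \<otimes> Y (- b)"
      by (simp_all add: n norm)
    then show "X k \<otimes> n \<in> ?S" "n \<otimes> Y k \<in> ?S" "r1 \<otimes> (n \<otimes> r1) \<in> ?S"
      by (simp_all only: I)
    show "n \<in> carrier G" by (simp add: n)
  qed
  have Y_S: "Y 1 \<otimes> n \<in> ?S" if n: "n \<in> ?S" for n
  proof -
    from n obtain k l where "n = X k \<otimes> Y l" by blast
    then have "Y 1 \<otimes> n = (Y 1 \<otimes> X k) \<otimes> Y l" by (simp add: m_assoc)
    then show ?thesis using S_Y[OF YX] by simp
  qed
  \<comment> \<open>\<open>Y (- 1)\<close> is reached from \<open>Y 1\<close> through conjugation by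
    \<open>r1\<close>, which maps \<open>?S\<close> into itself.\<close>
  have Y_S': "Y (- 1) \<otimes> n \<in> ?S" if n: "n \<in> ?S" for n
  proof -
    have "Y (- 1) \<otimes> n = r1 \<otimes> ((Y 1 \<otimes> (r1 \<otimes> (n \<otimes> r1))) \<otimes> r1)"
      using S_closed[OF n] by (simp add: norm)
    then show ?thesis using S_conj[OF Y_S[OF S_conj[OF n]]] by simp
  qed
  have "g \<otimes> n \<in> ?S" if "g \<in> generate G {X 1, Y 1}" "n \<in> ?S" for g n
    using that
  proof (induction arbitrary: n rule: generate.induct)
    case one
    then show ?case using S_closed by simp
  next
    case (incl h)
    then show ?case using X_S Y_S by blast
  next
    case (inv h)
    from inv(1) have "m_inv G h = X (- 1) \<or> m_inv G h = Y (- 1)" by auto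
    then show ?case using X_S[OF inv(2), of "- 1"] Y_S'[OF inv(2)] by (elim disjE ssubst)
  next
    case (eng h1 h2)
    have "h1 \<in> carrier G" "h2 \<in> carrier G"
      using eng generate_in_carrier[of "{X 1, Y 1}"] by auto
    then show ?case
      using eng.IH(1)[OF eng.IH(2)[OF eng.prems]] S_closed[OF eng.prems] by (simp add: m_assoc)
  qed
  from this[OF _ I[of 0 0]] show ?thesis
    using generate_in_carrier[of "{X 1, Y 1}"] by auto
qed

text \<open>Reducing exponents modulo \<open>p\<close> and \<open>q\<close> leaves at most
  \<open>p * q\<close> products in each half. The separate bound for the half without
  \<open>r1\<close> serves to show that this half cannot fill a group of order
  \<open>2 * p * q\<close>.\<close>

lemma card_NF_le:
  assumes p: "X (int p) = \<one>" "0 < p" and q: "Y (int q) = \<one>" "0 < q"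
  shows "finite NF" "card NF \<le> 2 * p * q" "card {X k \<otimes> Y l | k l. True} \<le> p * q"
proof -
  let ?A = "{0..<int p} \<times> {0..<int q}"
  have "X (int p * m) = \<one>" "Y (int q * m) = \<one>" for m
    using p(1) q(1) by (simp_all flip: X_pow Y_pow)
  then have X: "X (k mod int p) = X k" and Y: "Y (k mod int q) = Y k" for k
    using X_add[of "int p * (k div int p)" "k mod int p"]
      Y_add[of "int q * (k div int q)" "k mod int q"] by simp_all
  have image: "{f (X k) (Y l) | k l. True} = (\<lambda>(k, l). f (X k) (Y l)) ` ?A" for f :: "'a \<Rightarrow> 'a \<Rightarrow> 'a"
  proof (rule antisym; rule subsetI)
    fix z assume "z \<in> {f (X k) (Y l) | k l. True}"
    then obtain k l where "z = f (X (k mod int p)) (Y (l mod int q))" by (auto simp: X Y)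
    then show "z \<in> (\<lambda>(k, l). f (X k) (Y l)) ` ?A" using p(2) q(2) by auto
  qed auto
  have fin: "finite {f (X k) (Y l) | k l. True}"
    and card: "card {f (X k) (Y l) | k l. True} \<le> p * q" for f :: "'a \<Rightarrow> 'a \<Rightarrow> 'a"
  proof -
    show "finite {f (X k) (Y l) | k l. True}" unfolding image by simp
    have "card ((\<lambda>(k, l). f (X k) (Y l)) ` ?A) \<le> card ?A" by (rule card_image_le) simp
    then show "card {f (X k) (Y l) | k l. True} \<le> p * q" unfolding image by simp
  qed
  note fin1 = fin[of "\<lambda>a b. a \<otimes> b"] fin[of "\<lambda>a b. a \<otimes> (r1 \<otimes> b)"]
    and card1 = card[of "\<lambda>a b. a \<otimes> b"] card[of "\<lambda>a b. a \<otimes> (r1 \<otimes> b)"]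
  show "card {X k \<otimes> Y l | k l. True} \<le> p * q" by (rule card1)
  show "finite NF" using fin1 by (simp add: NF_def)
  show "card NF \<le> 2 * p * q"
    using card_Un_le[of "{X k \<otimes> Y l | k l. True}" "{X k \<otimes> (r1 \<otimes> Y l) | k l. True}"] card1
    unfolding NF_def by linarith
qed

section \<open>The dihedral subgroups generated by \<open>r0\<close>, \<open>r1\<close> and by
  \<open>r2\<close>, \<open>r1\<close>\<close>

definition dihedral :: "'a set" where
  "dihedral = {X k | k. True} \<union> {X k \<otimes> r1 | k. True}"

lemma dihedral_I: "X k \<in> dihedral" "X k \<otimes> r1 \<in> dihedral"
  by (auto simp: dihedral_def)

lemma dihedral_E:
  assumes "g \<in> dihedral" obtains k where "g = X k" | k where "g = X k \<otimes> r1"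
proof -
  have "(\<exists>k. g = X k) \<or> (\<exists>k. g = X k \<otimes> r1)" using assms by (simp add: dihedral_def)
  then show thesis by (elim disjE exE) (rule that, assumption)+
qed

lemma one_in_dihedral: "\<one> \<in> dihedral"
  using dihedral_I(1)[of 0] by simp

lemma dihedral_mult_r1: "g \<in> dihedral \<Longrightarrow> g \<otimes> r1 \<in> dihedral"
  by (erule dihedral_E) (simp_all add: norm dihedral_I)

lemma dihedral_mult_r0: "g \<in> dihedral \<Longrightarrow> g \<otimes> r0 \<in> dihedral"
proof -
  have "X k \<otimes> r1 \<otimes> (X 1 \<otimes> r1) = X (k - 1)" for k by (simp add: norm)
  moreover have "X 1 \<otimes> r1 = r0" by (simp add: X_1 m_assoc r1_invol)
  ultimately have *: "X k \<otimes> r1 \<otimes> r0 = X (k - 1)" for k by simp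
  have "X k \<otimes> (X 1 \<otimes> r1) = X (k + 1) \<otimes> r1" for k by (simp add: norm)
  then have **: "X k \<otimes> r0 = X (k + 1) \<otimes> r1" for k using \<open>X 1 \<otimes> r1 = r0\<close> by simp
  show "g \<in> dihedral \<Longrightarrow> g \<otimes> r0 \<in> dihedral"
    by (erule dihedral_E) (simp_all add: * ** dihedral_I)
qed

lemma dihedral_subset_generate: "dihedral \<subseteq> generate G {r0, r1}"
proof -
  have sub: "subgroup (generate G {r0, r1}) G" by (rule generate_is_subgroup) simp
  have gens: "r0 \<in> generate G {r0, r1}" "r1 \<in> generate G {r0, r1}" by (auto intro: generate.incl)
  then have "r0 \<otimes> r1 \<in> generate G {r0, r1}" by (rule generate.eng)
  then have "X k \<in> generate G {r0, r1}" for k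
    unfolding X_def by (rule subgroup_int_pow_closed[OF sub])
  then show ?thesis using gens(2) by (auto elim!: dihedral_E intro: generate.eng)
qed

lemma dihedral_swap: "string_triple.dihedral G r2 r1 = {Y k | k. True} \<union> {Y k \<otimes> r1 | k. True}"
proof -
  have "{f (Y (- k)) | k. True} = {f (Y k) | k. True}" for f :: "'a \<Rightarrow> 'a"
    by (metis minus_minus)
  from this[of "\<lambda>g. g"] this[of "\<lambda>g. g \<otimes> r1"] show ?thesis
    unfolding string_triple.dihedral_def[OF swap] X_swap by simp
qed

lemma dihedral_mult_NF:
  assumes "g \<in> dihedral" "h \<in> string_triple.dihedral G r2 r1" shows "g \<otimes> h \<in> NF"
proof -
  obtain l where "h = Y l \<or> h = Y l \<otimes> r1" using assms(2) unfolding dihedral_swap by blast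
  with assms(1) show ?thesis
    by (elim dihedral_E disjE) (simp_all add: norm NF_I)
qed

text \<open>Rotations and reflections are disjoint and equinumerous, so there are \<open>p\<close>
  rotations. If they met, \<open>r1\<close> would be a rotation, hence commute with
  \<open>X 1\<close> while also inverting it; then \<open>X 2 = \<one>\<close> and there are at most
  two elements, against \<open>2 \<le> p\<close>.\<close>

lemma X_period:
  assumes card: "card dihedral = 2 * p" and "2 \<le> p"
  shows "X (int p) = \<one>"
proof -
  let ?A = "{X k | k. True}" and ?B = "{X k \<otimes> r1 | k. True}"
  note card = card[unfolded dihedral_def]
  have fin: "finite (?A \<union> ?B)" using card assms(2) by (intro card_ge_0_finite) simp
  have "?A \<inter> ?B = {}"
  proof (rule ccontr)
    assume "?A \<inter> ?B \<noteq> {}"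
    then obtain k l where "X k = X l \<otimes> r1" by auto
    then have "X (- l) \<otimes> X k = X (- l) \<otimes> (X l \<otimes> r1)" by simp
    then have r1_eq: "r1 = X (k - l)" by (simp add: norm)
    have "X (- 1) \<otimes> r1 = r1 \<otimes> X 1" by (simp only: r1_X)
    also have "\<dots> = X 1 \<otimes> r1"
    proof -
      have "X (k - l) \<otimes> X 1 = X 1 \<otimes> X (k - l)" by (simp only: X_add add.commute)
      then show ?thesis by (simp only: r1_eq[symmetric])
    qed
    finally have "X (- 1) = X 1" by simp
    then have "X 1 \<otimes> X (- 1) = X 1 \<otimes> X 1" by simp
    then have "X 2 = \<one>" by (simp add: norm)
    then have two: "X (2 * m) = \<one>" for m using X_pow[of 2 m] by simp
    have "?A \<union> ?B \<subseteq> {\<one>, X 1}"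
    proof
      fix g assume "g \<in> ?A \<union> ?B"
      moreover have "X m \<otimes> r1 = X (m + (k - l))" for m
        by (simp only: X_add[symmetric] r1_eq[symmetric])
      ultimately obtain k where k: "g = X k" by blast
      have "X k = X (2 * (k div 2)) \<otimes> X (k mod 2)" by (simp add: X_add)
      then have "X k = X (k mod 2)" by (simp add: two)
      moreover have "k mod 2 = 0 \<or> k mod 2 = 1" by presburger
      ultimately show "g \<in> {\<one>, X 1}" using k by auto
    qed
    then have "card (?A \<union> ?B) \<le> card {\<one>, X 1}" by (rule card_mono[rotated]) simp
    also have "\<dots> \<le> 2" by (simp add: card_insert_if)
    finally show False using card assms(2) by simp
  qed
  then have "card (?A \<union> ?B) = card ?A + card ?B"
    using fin by (intro card_Un_disjoint) auto
  moreover have "?B = (\<lambda>g. g \<otimes> r1) ` ?A" by auto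
  moreover have "card ((\<lambda>g. g \<otimes> r1) ` ?A) = card ?A"
    by (rule card_image) (auto intro!: inj_onI)
  ultimately have "card ?A = p" using card by simp
  moreover have "generate G {r0 \<otimes> r1} = ?A"
    by (auto simp: generate_pow X_def)
  ultimately have "ord (r0 \<otimes> r1) = p"
    by (simp add: generate_pow_card)
  then show ?thesis
    using pow_ord_eq_1[of "r0 \<otimes> r1"] by (simp add: X_def int_pow_int)
qed

text \<open>The second alternative consists of the relations of the first one for the triple
  \<open>(r2, r1, r0)\<close>, which has \<open>Y (- 1)\<close> and \<open>X (- 1)\<close> in place of \<open>X 1\<close> and \<open>Y 1\<close>.\<close>

lemma tight_relations_exist:
  assumes p: "X (int p) = \<one>" "0 < p" and q: "Y (int q) = \<one>" "0 < q"
    and NF: "carrier G = NF" and card: "card (carrier G) = 2 * p * q"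
    and gen: "generate G {X 1, Y 1} = carrier G"
  obtains i j a b where "Y (- 1) \<otimes> X 1 = X i \<otimes> (r1 \<otimes> Y j)" "Y (- 2) \<otimes> X 1 = X a \<otimes> Y b"
  | i j a b where "X 1 \<otimes> Y (- 1) = Y (- i) \<otimes> (r1 \<otimes> X (- j))" "X 2 \<otimes> Y (- 1) = Y (- a) \<otimes> X (- b)"
proof -
  have "Y (- 1) \<otimes> X 1 \<in> NF" "Y (- 2) \<otimes> X 1 \<in> NF"
    using NF by auto
  have "\<nexists>i j. Y (- 1) \<otimes> X 1 = X i \<otimes> Y j"
  proof
    assume "\<exists>i j. Y (- 1) \<otimes> X 1 = X i \<otimes> Y j"
    then have "carrier G \<subseteq> {X k \<otimes> Y l | k l. True}"
      using generate_rotations gen by blast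
    moreover have "{X k \<otimes> Y l | k l. True} \<subseteq> NF" by blast
    ultimately have "card (carrier G) \<le> p * q"
      using NF card_NF_le(3)[OF p q] by (metis subset_antisym)
    then show False using card p q by simp
  qed
  then obtain i j where R1: "Y (- 1) \<otimes> X 1 = X i \<otimes> (r1 \<otimes> Y j)"
    using \<open>Y (- 1) \<otimes> X 1 \<in> NF\<close> by (blast elim: NF_E)
  show thesis
    using \<open>Y (- 2) \<otimes> X 1 \<in> NF\<close>
  proof (cases rule: NF_E)
    case (1 a b)
    then show ?thesis using that(1) R1 by blast
  next
    case (2 a b)
    have "Y (- 2) \<otimes> X 1 = Y (- 1) \<otimes> (Y (- 1) \<otimes> X 1)" by (simp add: norm)
    \<comment> \<open>Both \<open>Y (- 1) \<otimes> X 1\<close> and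
      \<open>Y (- 2) \<otimes> X 1\<close> carry an \<open>r1\<close>; the two cancel, and
      \<open>Y (- 1) \<otimes> X i\<close> acquires a normal form without it.\<close>
    then have "X a \<otimes> (r1 \<otimes> Y b) = Y (- 1) \<otimes> (X i \<otimes> (r1 \<otimes> Y j))"
      by (simp only: R1 2)
    then have "X a \<otimes> (r1 \<otimes> Y b) \<otimes> Y (- j) \<otimes> r1 = Y (- 1) \<otimes> (X i \<otimes> (r1 \<otimes> Y j)) \<otimes> Y (- j) \<otimes> r1"
      by simp
    then have e: "Y (- 1) \<otimes> X i = X a \<otimes> Y (j - b)" by (simp add: norm)
    \<comment> \<open>To pass from the exponent \<open>i\<close> to 2, write \<open>X 2\<close> as
      \<open>X (2 - i) \<otimes> X i\<close>: \<open>Y 1\<close>, and hence \<open>Y (- 1)\<close>,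
      inverts the first factor.\<close>
    have "inverted (2 - i)" using inverted_minus[OF inverted_of_relation[OF R1]] by simp
    then have I: "Y 1 \<otimes> X (2 - i) = X (i - 2) \<otimes> Y 1" by (simp add: inverted_def)
    have "Y (- 1) \<otimes> X (2 - i) = Y (- 1) \<otimes> (X (2 - i) \<otimes> Y 1) \<otimes> Y (- 1)" by (simp add: norm)
    also have "X (2 - i) \<otimes> Y 1 = X (2 - i) \<otimes> (Y 1 \<otimes> X (2 - i)) \<otimes> X (i - 2)" by (simp add: norm)
    also have "\<dots> = Y 1 \<otimes> X (i - 2)" by (simp only: I) (simp add: norm)
    also have "Y (- 1) \<otimes> (Y 1 \<otimes> X (i - 2)) \<otimes> Y (- 1) = X (i - 2) \<otimes> Y (- 1)" by (simp add: norm)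
    finally have I': "Y (- 1) \<otimes> X (2 - i) = X (i - 2) \<otimes> Y (- 1)" .
    have "Y (- 1) \<otimes> X 2 = (Y (- 1) \<otimes> X (2 - i)) \<otimes> X i" by (simp add: norm)
    also have "\<dots> = X (i - 2) \<otimes> (Y (- 1) \<otimes> X i)" by (simp only: I') (simp add: norm)
    also have "\<dots> = X (i - 2 + a) \<otimes> Y (j - b)" by (simp only: e) (simp add: norm)
    finally have e2: "Y (- 1) \<otimes> X 2 = X (i - 2 + a) \<otimes> Y (j - b)" .
    define c d where "c = i - 2 + a" and "d = j - b"
    \<comment> \<open>Conjugation by \<open>r1\<close> followed by inversion reverses the factors
      and keeps the exponents, which is the order wanted for the reversed triple.\<close>
    have "Y 1 \<otimes> X (- 2) = X (- c) \<otimes> Y (- d)"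
      using conj_relation0[OF e2] by (simp only: c_def d_def minus_minus)
    then have "inv (Y 1 \<otimes> X (- 2)) = inv (X (- c) \<otimes> Y (- d))" by simp
    then have "X 2 \<otimes> Y (- 1) = Y d \<otimes> X c"
      by (simp add: inv_mult_group)
    moreover have "inv (Y 1 \<otimes> X (- 1)) = inv (X (- i) \<otimes> (r1 \<otimes> Y (- j)))"
      using conj_relation[OF R1] by simp
    then have "X 1 \<otimes> Y (- 1) = Y j \<otimes> (r1 \<otimes> X i)"
      by (simp add: inv_mult_group m_assoc)
    ultimately show ?thesis
      by (intro that(2)[of "- j" "- i" "- d" "- c"]) simp_all
  qed
qed

end

section \<open>Presented groups and their quotients\<close>

primrec (in group) word_value :: "('g \<Rightarrow> 'a) \<Rightarrow> 'g word \<Rightarrow> 'a" where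
  "word_value f [] = \<one>"
| "word_value f (l # w) = (if snd l then f (fst l) else inv (f (fst l))) \<otimes> word_value f w"

context group
begin

lemma word_value_closed [simp]:
  assumes "range f \<subseteq> carrier G" shows "word_value f w \<in> carrier G"
  using assms by (induction w) auto

lemma word_value_append:
  assumes "range f \<subseteq> carrier G"
  shows "word_value f (u @ v) = word_value f u \<otimes> word_value f v"
  using assms by (induction u) (auto simp: m_assoc range_subsetD)

lemma word_value_power:
  assumes f: "range f \<subseteq> carrier G"
  shows "word_value f (word_power w n) = word_value f w [^] n"
proof (induction n)
  case (Suc n)
  have "word_value f w \<otimes> word_value f w [^] n = word_value f w [^] n \<otimes> word_value f w"
    using nat_pow_Suc2[OF word_value_closed[OF f]] by simp
  with Suc show ?case by (simp add: word_power_def word_value_append[OF f])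
qed (simp add: word_power_def)

lemma word_value_cong:
  assumes f: "range f \<subseteq> carrier G" and R: "\<And>r. r \<in> R \<Longrightarrow> word_value f r = \<one>"
    and "word_eq R u v"
  shows "word_value f u = word_value f v"
  using assms(3)
proof (induction rule: word_eq.induct)
  case (cancel u g b v)
  have "f g \<in> carrier G" using f by auto
  then show ?case using f
    by (simp add: word_value_append[OF f]) (simp add: m_assoc[symmetric])
next
  case (relator r u v)
  then show ?case using f by (simp add: word_value_append[OF f] R)
qed auto

text \<open>The map evaluates an arbitrary representative of a class; \<open>word_value_cong\<close>
  makes the choice irrelevant.\<close>

lemma presented_group_universal:
  assumes f: "range f \<subseteq> carrier G" and R: "\<And>r. r \<in> R \<Longrightarrow> word_value f r = \<one>"
  obtains \<phi> where "\<phi> \<in> hom (presented_group R) G" "\<And>w. \<phi> (word_class R w) = word_value f w"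
proof
  define \<phi> where "\<phi> A = word_value f (SOME w. w \<in> A)" for A
  show *: "\<phi> (word_class R w) = word_value f w" for w
  proof -
    have "w \<in> word_class R w" by (simp add: word_class_def word_eq.refl)
    then have "(SOME v. v \<in> word_class R w) \<in> word_class R w" by (rule someI)
    then have "word_eq R w (SOME v. v \<in> word_class R w)" by (simp add: word_class_def)
    from word_value_cong[OF f R this] show ?thesis by (simp add: \<phi>_def)
  qed
  have "carrier (presented_group R) = range (word_class R)" by (simp add: presented_group_def)
  then show "\<phi> \<in> hom (presented_group R) G"
    using f by (auto simp: hom_def presented_group_mult * word_value_append[OF f])
qed

lemma normal_closure_normal:
  assumes "S \<subseteq> carrier G" shows "normal_closure G S \<lhd> G"
proof -
  have "{N. N \<lhd> G \<and> S \<subseteq> N} \<noteq> {}"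
    using assms normal_self by blast
  moreover have "\<And>N. N \<in> {N. N \<lhd> G \<and> S \<subseteq> N} \<Longrightarrow> subgroup N G"
    by (simp add: normal_imp_subgroup)
  ultimately have "subgroup (normal_closure G S) G"
    unfolding normal_closure_def by (rule subgroups_Inter[rotated])
  then show ?thesis
    unfolding normal_inv_iff by (auto simp: normal_closure_def normal_inv_iff)
qed

lemma subset_normal_closure: "S \<subseteq> normal_closure G S"
  by (auto simp: normal_closure_def)

lemma normal_closure_least: "N \<lhd> G \<Longrightarrow> S \<subseteq> N \<Longrightarrow> normal_closure G S \<subseteq> N"
  by (auto simp: normal_closure_def)

end

lemma generate_presented_group:
  "generate (presented_group R) (range (\<lambda>g. word_class R [(g, True)])) = carrier (presented_group R)"
    (is "generate ?W ?S = _")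
proof
  interpret W: group ?W by (rule group_presented_group)
  have carrier: "carrier ?W = range (word_class R)" and one: "\<one>\<^bsub>?W\<^esub> = word_class R []"
    by (simp_all add: presented_group_def)
  show "generate ?W ?S \<subseteq> carrier ?W"
    by (rule W.generate_incl) (auto simp: carrier)
  have letter: "word_class R [(g, b)] \<in> generate ?W ?S" for g b
  proof (cases b)
    case False
    have "word_class R [(g, False)] \<otimes>\<^bsub>?W\<^esub> word_class R [(g, True)] = \<one>\<^bsub>?W\<^esub>"
      using word_eq.cancel[of R "[]" g False "[]"] by (simp add: presented_group_mult one word_class_eq_iff)
    then have "inv\<^bsub>?W\<^esub> word_class R [(g, True)] = word_class R [(g, False)]"
      by (rule W.inv_equality) (auto simp: carrier)
    then show ?thesis using False generate.inv[of "word_class R [(g, True)]" ?S ?W] by simp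
  qed (auto intro: generate.incl)
  have "word_class R w \<in> generate ?W ?S" for w
  proof (induction w)
    case Nil
    show ?case by (simp add: generate.one flip: one)
  next
    case (Cons l w)
    show ?case
      using generate.eng[OF letter[of "fst l" "snd l"] Cons] by (simp add: presented_group_mult)
  qed
  then show "carrier ?W \<subseteq> generate ?W ?S" by (auto simp: carrier)
qed

section \<open>The Coxeter group and its quotient by the tight relations\<close>

lemma UNIV_coxeter_gen: "UNIV = {Gen_x, Gen_y, Gen_z}"
  using coxeter_gen.exhaust by auto

lemma group_coxeter_group: "group (coxeter_group p q)"
  by (simp add: coxeter_group_def group_presented_group)

lemma coxeter_elt_closed [simp]: "coxeter_elt p q g \<in> carrier (coxeter_group p q)"
  by (simp add: coxeter_elt_def coxeter_group_def presented_group_def)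

lemma generate_coxeter_group:
  "generate (coxeter_group p q) {coxeter_elt p q Gen_x, coxeter_elt p q Gen_y, coxeter_elt p q Gen_z}
    = carrier (coxeter_group p q)"
  using generate_presented_group[of "coxeter_relators p q"]
  by (simp add: coxeter_group_def coxeter_elt_def UNIV_coxeter_gen)

lemma coxeter_word_power:
  "word_class (coxeter_relators p q) (word_power w n) =
    word_class (coxeter_relators p q) w [^]\<^bsub>coxeter_group p q\<^esub> n"
proof -
  interpret W: group "coxeter_group p q" by (rule group_coxeter_group)
  have mult: "word_class (coxeter_relators p q) u \<otimes>\<^bsub>coxeter_group p q\<^esub> word_class (coxeter_relators p q) v
      = word_class (coxeter_relators p q) (u @ v)" for u v
    by (simp add: coxeter_group_def presented_group_mult)
  have closed: "word_class (coxeter_relators p q) w \<in> carrier (coxeter_group p q)" for w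
    by (simp add: coxeter_group_def presented_group_def)
  show ?thesis
  proof (induction n)
    case 0
    show ?case by (simp add: word_power_def) (simp add: coxeter_group_def presented_group_def)
  next
    case (Suc n)
    show ?case
      unfolding W.nat_pow_Suc2[OF closed] Suc[symmetric] mult by (simp add: word_power_def)
  qed
qed

lemma coxeter_relations:
  fixes p q defines "W \<equiv> coxeter_group p q"
    and "x \<equiv> coxeter_elt p q Gen_x" and "y \<equiv> coxeter_elt p q Gen_y" and "z \<equiv> coxeter_elt p q Gen_z"
  shows "string_triple W x y z" "(x \<otimes>\<^bsub>W\<^esub> y) [^]\<^bsub>W\<^esub> p = \<one>\<^bsub>W\<^esub>" "(y \<otimes>\<^bsub>W\<^esub> z) [^]\<^bsub>W\<^esub> q = \<one>\<^bsub>W\<^esub>"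
proof -
  interpret W: group W unfolding W_def by (rule group_coxeter_group)
  have closed: "x \<in> carrier W" "y \<in> carrier W" "z \<in> carrier W"
    by (simp_all add: W_def x_def y_def z_def)
  have letter: "word_class (coxeter_relators p q) [(g, True)] = coxeter_elt p q g"
    and pair: "word_class (coxeter_relators p q) [(g, True), (h, True)] =
      coxeter_elt p q g \<otimes>\<^bsub>W\<^esub> coxeter_elt p q h" for g h
    by (simp_all add: W_def coxeter_elt_def coxeter_group_def presented_group_mult)
  have rel: "word_class (coxeter_relators p q) w [^]\<^bsub>W\<^esub> n = \<one>\<^bsub>W\<^esub>"
    if "word_power w n \<in> coxeter_relators p q" for w n
    using word_eq.relator[OF that, of "[]" "[]"]
    by (simp add: W_def flip: coxeter_word_power)
       (simp add: coxeter_group_def presented_group_def word_class_eq_iff)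
  have "x [^]\<^bsub>W\<^esub> (2::nat) = \<one>\<^bsub>W\<^esub>" "y [^]\<^bsub>W\<^esub> (2::nat) = \<one>\<^bsub>W\<^esub>" "z [^]\<^bsub>W\<^esub> (2::nat) = \<one>\<^bsub>W\<^esub>"
    "(x \<otimes>\<^bsub>W\<^esub> z) [^]\<^bsub>W\<^esub> (2::nat) = \<one>\<^bsub>W\<^esub>"
    and pq: "(x \<otimes>\<^bsub>W\<^esub> y) [^]\<^bsub>W\<^esub> p = \<one>\<^bsub>W\<^esub>" "(y \<otimes>\<^bsub>W\<^esub> z) [^]\<^bsub>W\<^esub> q = \<one>\<^bsub>W\<^esub>"
    unfolding x_def y_def z_def pair[symmetric] unfolding letter[symmetric]
    by (rule rel; simp add: coxeter_relators_def Let_def)+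
  then have invol: "x \<otimes>\<^bsub>W\<^esub> x = \<one>\<^bsub>W\<^esub>" "y \<otimes>\<^bsub>W\<^esub> y = \<one>\<^bsub>W\<^esub>" "z \<otimes>\<^bsub>W\<^esub> z = \<one>\<^bsub>W\<^esub>"
    and "(x \<otimes>\<^bsub>W\<^esub> z) \<otimes>\<^bsub>W\<^esub> (x \<otimes>\<^bsub>W\<^esub> z) = \<one>\<^bsub>W\<^esub>"
    using closed by (simp_all add: numeral_2_eq_2)
  \<comment> \<open>Commutation of \<open>x\<close> and \<open>z\<close> is not itself a relator:
    their product is its own inverse, and inverting it swaps the two involutions.\<close>
  then have "inv\<^bsub>W\<^esub> (x \<otimes>\<^bsub>W\<^esub> z) = x \<otimes>\<^bsub>W\<^esub> z" "inv\<^bsub>W\<^esub> x = x" "inv\<^bsub>W\<^esub> z = z"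
    using closed by (metis W.inv_equality W.m_closed)+
  then have "x \<otimes>\<^bsub>W\<^esub> z = z \<otimes>\<^bsub>W\<^esub> x"
    using W.inv_mult_group closed by metis
  with closed invol show "string_triple W x y z"
    by unfold_locales
  show "(x \<otimes>\<^bsub>W\<^esub> y) [^]\<^bsub>W\<^esub> p = \<one>\<^bsub>W\<^esub>" "(y \<otimes>\<^bsub>W\<^esub> z) [^]\<^bsub>W\<^esub> q = \<one>\<^bsub>W\<^esub>" by (rule pq)+
qed

text \<open>Transfers relations between \<open>X\<close> and \<open>Y\<close> along homomorphisms:
  the projection of the Coxeter group to its quotient and its evaluation in the target
  group.\<close>

lemma string_triple_hom:
  assumes "string_triple G r0 r1 r2" "group_hom G H h"
  shows "string_triple H (h r0) (h r1) (h r2)"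
    and "h (string_triple.X G r0 r1 k) = string_triple.X H (h r0) (h r1) k"
    and "h (string_triple.Y G r1 r2 k) = string_triple.Y H (h r1) (h r2) k"
proof -
  interpret G: string_triple G r0 r1 r2 by fact
  interpret group_hom G H h by fact
  show *: "string_triple H (h r0) (h r1) (h r2)"
    by unfold_locales (simp_all add: G.r0_invol G.r1_invol G.r2_invol G.r0_r2_commute flip: hom_mult)
  show "h (G.X k) = string_triple.X H (h r0) (h r1) k" "h (G.Y k) = string_triple.Y H (h r1) (h r2) k"
    unfolding G.X_def G.Y_def string_triple.X_def[OF *] string_triple.Y_def[OF *]
    by (simp_all add: hom_int_pow)
qed

lemma tight_relations_eq:
  fixes p q defines "W \<equiv> coxeter_group p q"
    and "x \<equiv> coxeter_elt p q Gen_x" and "y \<equiv> coxeter_elt p q Gen_y" and "z \<equiv> coxeter_elt p q Gen_z"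
  defines "X \<equiv> string_triple.X W x y" and "Y \<equiv> string_triple.Y W y z"
  shows "tight_relations p q i j a b =
    {(Y (- 1) \<otimes>\<^bsub>W\<^esub> X 1, X i \<otimes>\<^bsub>W\<^esub> (y \<otimes>\<^bsub>W\<^esub> Y j)), (Y (- 2) \<otimes>\<^bsub>W\<^esub> X 1, X a \<otimes>\<^bsub>W\<^esub> Y b)}"
proof -
  interpret W: string_triple W x y z
    unfolding W_def x_def y_def z_def by (rule coxeter_relations)
  have X: "(x \<otimes>\<^bsub>W\<^esub> y) [^]\<^bsub>W\<^esub> k = X k" and Y: "(y \<otimes>\<^bsub>W\<^esub> z) [^]\<^bsub>W\<^esub> k = Y k" for k :: int
    by (simp_all add: X_def Y_def W.X_def W.Y_def)
  have closed: "X k \<in> carrier W" "Y k \<in> carrier W" for k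
    by (simp_all add: X_def Y_def)
  have "inv\<^bsub>W\<^esub> (y \<otimes>\<^bsub>W\<^esub> z) = Y (- 1)" "x \<otimes>\<^bsub>W\<^esub> y = X 1"
    using W.inv_Y[of 1] by (simp_all add: X_def Y_def W.X_1 W.Y_1)
  then show ?thesis
    unfolding tight_relations_def Let_def W_def[symmetric] x_def[symmetric] y_def[symmetric]
      z_def[symmetric] X Y by (simp add: W.m_assoc closed)
qed

text \<open>The target is any group of order \<open>2 * p * q\<close> with a generating triple,
  which covers \<Gamma> with its generators in either order, the reversed one belonging to the
  dual.\<close>

lemma coxeter_quotient_iso:
  fixes H :: "('a, 'm) monoid_scheme" and p q :: nat
  assumes triple: "string_triple H s0 s1 s2"
    and gen: "generate H {s0, s1, s2} = carrier H"
    and p: "string_triple.X H s0 s1 (int p) = \<one>\<^bsub>H\<^esub>" "0 < p"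
    and q: "string_triple.Y H s1 s2 (int q) = \<one>\<^bsub>H\<^esub>" "0 < q"
    and card: "card (carrier H) = 2 * p * q"
    and R1: "string_triple.Y H s1 s2 (- 1) \<otimes>\<^bsub>H\<^esub> string_triple.X H s0 s1 1 =
      string_triple.X H s0 s1 i \<otimes>\<^bsub>H\<^esub> (s1 \<otimes>\<^bsub>H\<^esub> string_triple.Y H s1 s2 j)"
    and R2: "string_triple.Y H s1 s2 (- 2) \<otimes>\<^bsub>H\<^esub> string_triple.X H s0 s1 1 =
      string_triple.X H s0 s1 a \<otimes>\<^bsub>H\<^esub> string_triple.Y H s1 s2 b"
  defines "W \<equiv> coxeter_group p q" and "Rel \<equiv> tight_relations p q i j a b"
  shows "\<exists>h \<in> iso (quotient_by_relations W Rel) H.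
    h (quotient_class W Rel (coxeter_elt p q Gen_x)) = s0 \<and>
    h (quotient_class W Rel (coxeter_elt p q Gen_y)) = s1 \<and>
    h (quotient_class W Rel (coxeter_elt p q Gen_z)) = s2"
proof -
  interpret H: string_triple H s0 s1 s2 by fact
  define f where "f = case_coxeter_gen s0 s1 s2"
  have f_simps: "f Gen_x = s0" "f Gen_y = s1" "f Gen_z = s2" by (simp_all add: f_def)
  have f: "range f \<subseteq> carrier H" by (simp add: UNIV_coxeter_gen f_simps)
  have val: "H.word_value f [(g, True)] = f g"
    "H.word_value f [(g, True), (g', True)] = f g \<otimes>\<^bsub>H\<^esub> f g'" for g g'
    using f by (auto simp: subset_iff)
  have comm: "(s0 \<otimes>\<^bsub>H\<^esub> s2) \<otimes>\<^bsub>H\<^esub> (s0 \<otimes>\<^bsub>H\<^esub> s2) = \<one>\<^bsub>H\<^esub>"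
  proof -
    have "(s0 \<otimes>\<^bsub>H\<^esub> s2) \<otimes>\<^bsub>H\<^esub> (s0 \<otimes>\<^bsub>H\<^esub> s2) = (s0 \<otimes>\<^bsub>H\<^esub> s2) \<otimes>\<^bsub>H\<^esub> (s2 \<otimes>\<^bsub>H\<^esub> s0)"
      by (simp only: H.r0_r2_commute)
    then show ?thesis by (simp add: H.m_assoc H.cancel_invol H.r0_invol)
  qed
  have "H.word_value f r = \<one>\<^bsub>H\<^esub>" if "r \<in> coxeter_relators p q" for r
    using that p(1) q(1) comm
    by (auto simp: coxeter_relators_def Let_def H.word_value_power[OF f] val f_simps int_pow_int
        numeral_2_eq_2 H.r0_invol H.r1_invol H.r2_invol H.X_def H.Y_def simp del: H.word_value.simps)
  from H.presented_group_universal[OF f this]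
  obtain \<phi> where \<phi>: "\<phi> \<in> hom W H" and \<phi>_class: "\<And>w. \<phi> (word_class (coxeter_relators p q) w) = H.word_value f w"
    unfolding W_def coxeter_group_def by blast
  define x y z where "x = coxeter_elt p q Gen_x" and "y = coxeter_elt p q Gen_y" and "z = coxeter_elt p q Gen_z"
  note xyz = x_def y_def z_def
  have \<phi>_gens: "\<phi> x = s0" "\<phi> y = s1" "\<phi> z = s2"
    by (simp_all add: xyz coxeter_elt_def \<phi>_class val f_simps del: H.word_value.simps)
  interpret W: string_triple W x y z
    unfolding W_def xyz by (rule coxeter_relations)
  interpret \<phi>: group_hom W H \<phi>
    by unfold_locales (rule \<phi>)
  note \<phi>_X = string_triple_hom(2)[OF W.string_triple_axioms \<phi>.group_hom_axioms, unfolded \<phi>_gens]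
    and \<phi>_Y = string_triple_hom(3)[OF W.string_triple_axioms \<phi>.group_hom_axioms, unfolded \<phi>_gens]

  define S where "S = {u \<otimes>\<^bsub>W\<^esub> inv\<^bsub>W\<^esub> v | u v. (u, v) \<in> Rel}"
  define N where "N = normal_closure W S"
  have Rel: "Rel = {(W.Y (- 1) \<otimes>\<^bsub>W\<^esub> W.X 1, W.X i \<otimes>\<^bsub>W\<^esub> (y \<otimes>\<^bsub>W\<^esub> W.Y j)),
      (W.Y (- 2) \<otimes>\<^bsub>W\<^esub> W.X 1, W.X a \<otimes>\<^bsub>W\<^esub> W.Y b)}"
    unfolding Rel_def tight_relations_eq W_def xyz ..
  have S: "S \<subseteq> carrier W" by (auto simp: S_def Rel)
  have N: "N \<lhd> W" unfolding N_def using S by (rule W.normal_closure_normal)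
  interpret N: normal N W by (rule N)
  define Q where "Q = W Mod N"
  define \<pi> where "\<pi> = (\<lambda>g. N #>\<^bsub>W\<^esub> g)"
  interpret Q: group Q unfolding Q_def by (rule N.factorgroup_is_group)
  interpret \<pi>: group_hom W Q \<pi>
    by unfold_locales (simp add: \<pi>_def Q_def N.r_coset_hom_Mod)
  have Q_carrier: "carrier Q = \<pi> ` carrier W"
    by (auto simp: Q_def \<pi>_def FactGroup_def RCOSETS_def)
  interpret Q: string_triple Q "\<pi> x" "\<pi> y" "\<pi> z"
    by (rule string_triple_hom(1)[OF W.string_triple_axioms \<pi>.group_hom_axioms])
  note \<pi>_X = string_triple_hom(2)[OF W.string_triple_axioms \<pi>.group_hom_axioms]
    and \<pi>_Y = string_triple_hom(3)[OF W.string_triple_axioms \<pi>.group_hom_axioms]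

  have \<pi>_eq: "\<pi> u = \<pi> v" if "(u, v) \<in> Rel" for u v
  proof -
    have uv: "u \<in> carrier W" "v \<in> carrier W" using that by (auto simp: Rel)
    have "u \<otimes>\<^bsub>W\<^esub> inv\<^bsub>W\<^esub> v \<in> S"
      unfolding S_def using that by blast
    then have "u \<otimes>\<^bsub>W\<^esub> inv\<^bsub>W\<^esub> v \<in> N"
      unfolding N_def by (rule subsetD[OF W.subset_normal_closure])
    then have "\<pi> (u \<otimes>\<^bsub>W\<^esub> inv\<^bsub>W\<^esub> v) = \<one>\<^bsub>Q\<^esub>"
      by (simp add: \<pi>_def Q_def FactGroup_def W.coset_join2 N.subgroup_axioms uv)
    then have "\<pi> u \<otimes>\<^bsub>Q\<^esub> inv\<^bsub>Q\<^esub> \<pi> v = \<one>\<^bsub>Q\<^esub>" using uv by simp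
    then have "inv\<^bsub>Q\<^esub> (inv\<^bsub>Q\<^esub> \<pi> v) = \<pi> u"
      by (rule Q.inv_equality) (simp_all add: uv)
    then show ?thesis using uv by simp
  qed
  have "generate Q {\<pi> x, \<pi> y, \<pi> z} = \<pi> ` generate W {x, y, z}"
    by (subst \<pi>.generate_img[symmetric]) simp_all
  also have "generate W {x, y, z} = carrier W"
    unfolding W_def xyz by (rule generate_coxeter_group)
  finally have gen_Q: "generate Q {\<pi> x, \<pi> y, \<pi> z} = carrier Q"
    by (simp add: Q_carrier)
  have "\<pi> (W.Y (- 1) \<otimes>\<^bsub>W\<^esub> W.X 1) = \<pi> (W.X i \<otimes>\<^bsub>W\<^esub> (y \<otimes>\<^bsub>W\<^esub> W.Y j))"
    "\<pi> (W.Y (- 2) \<otimes>\<^bsub>W\<^esub> W.X 1) = \<pi> (W.X a \<otimes>\<^bsub>W\<^esub> W.Y b)"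
    by (rule \<pi>_eq; simp add: Rel)+
  \<comment> \<open>The calculation with string triples takes place in the quotient itself, without
    reference to \<open>H\<close>.\<close>
  then have "carrier Q \<subseteq> Q.NF"
    using Q.generate_subset_NF_of_relations[of i j a b] gen_Q by (simp add: \<pi>_X \<pi>_Y)
  moreover have "Q.X (int p) = \<one>\<^bsub>Q\<^esub>" "Q.Y (int q) = \<one>\<^bsub>Q\<^esub>"
  proof -
    have "W.X (int p) = \<one>\<^bsub>W\<^esub>" "W.Y (int q) = \<one>\<^bsub>W\<^esub>"
      unfolding W.X_def W.Y_def int_pow_int unfolding xyz W_def by (rule coxeter_relations)+
    then show "Q.X (int p) = \<one>\<^bsub>Q\<^esub>" "Q.Y (int q) = \<one>\<^bsub>Q\<^esub>"
      unfolding \<pi>_X[symmetric] \<pi>_Y[symmetric] by simp_all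
  qed
  note NF_card = Q.card_NF_le[OF this(1) p(2) this(2) q(2)]
  ultimately have Q_card: "finite (carrier Q)" "card (carrier Q) \<le> card (carrier H)"
    unfolding card using finite_subset card_mono[OF NF_card(1)] le_trans[OF _ NF_card(2)] by blast+

  \<comment> \<open>\<open>H\<close> satisfies the two relations, so the evaluation
    \<open>\<phi>\<close> factors through \<open>Q\<close>; the image is all of \<open>H\<close>
    because the triple generates it.\<close>
  have "S \<subseteq> kernel W H \<phi>"
    using R1 R2 by (auto simp: S_def Rel kernel_def \<phi>_X \<phi>_Y \<phi>_gens)
  then have "N \<subseteq> kernel W H \<phi>"
    unfolding N_def by (rule W.normal_closure_least[OF \<phi>.normal_kernel])
  from \<phi>.FactGroup_universal_kernel[OF N this]
  obtain h where h: "h \<in> hom Q H" and h_\<pi>: "\<And>g. g \<in> carrier W \<Longrightarrow> h (\<pi> g) = \<phi> g"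
    unfolding Q_def \<pi>_def by blast
  have "carrier H = \<phi> ` generate W {x, y, z}"
    by (subst \<phi>.generate_img[symmetric]) (simp_all add: \<phi>_gens gen)
  also have "generate W {x, y, z} = carrier W"
    unfolding W_def xyz by (rule generate_coxeter_group)
  finally have surj: "h ` carrier Q = carrier H"
    by (simp add: Q_carrier image_image h_\<pi>)
  then have "inj_on h (carrier Q)"
    using Q_card by (metis card_image_le eq_card_imp_inj_on le_antisym)
  with surj h have "h \<in> iso Q H"
    by (simp add: iso_def bij_betw_def)
  moreover have "h (\<pi> x) = s0" "h (\<pi> y) = s1" "h (\<pi> z) = s2"
    by (simp_all add: h_\<pi> \<phi>_gens)
  ultimately show ?thesis
    unfolding quotient_by_relations_def quotient_class_def xyz Q_def N_def S_def \<pi>_def by blast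
qed

section \<open>Flags of a polyhedron\<close>

text \<open>Serves for the edges and faces at a vertex and for the vertices and edges of a face. The
  isomorphism respects levels: every edge of the graph has an end below it and every vertex an edge
  above it, whereas in \<open>A\<close> only members of \<open>M\<close> lie strictly above others
  and only members of \<open>L\<close> strictly below. Degrees and connectedness then carry
  over.\<close>

lemma two_level_polygonal:
  assumes poly: "polygonal A r" and A: "A = L \<union> M" "L \<inter> M = {}"
    and strict: "\<And>x y. x \<in> A \<Longrightarrow> y \<in> A \<Longrightarrow> (x, y) \<in> r \<Longrightarrow> x \<noteq> y \<Longrightarrow> x \<in> L \<and> y \<in> M"
  shows "\<And>l. l \<in> L \<Longrightarrow> card {m \<in> M. (l, m) \<in> r} = 2"
    and "\<And>l l'. l \<in> L \<Longrightarrow> l' \<in> L \<Longrightarrow>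
      (l, l') \<in> {(a, b). a \<in> L \<and> b \<in> L \<and> (\<exists>m\<in>M. (a, m) \<in> r \<and> (b, m) \<in> r)}\<^sup>*"
proof -
  obtain V E :: "'a set" and ends where conn: "connected_graph V E ends"
    and reg: "two_regular_graph V E ends"
    and iso: "order_isomorphic A r (V <+> E) (incidence_order V E ends)"
    using poly by (auto simp: polygonal_def)
  then obtain f where f: "bij_betw f A (V <+> E)"
    and f_le: "\<And>x y. x \<in> A \<Longrightarrow> y \<in> A \<Longrightarrow> (x, y) \<in> r \<longleftrightarrow> (f x, f y) \<in> incidence_order V E ends"
    by (auto simp: order_isomorphic_def)
  have graph: "\<And>e. e \<in> E \<Longrightarrow> ends e \<subseteq> V \<and> card (ends e) = 2"
    using conn by (auto simp: connected_graph_def graph_def)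
  have deg: "\<And>v. v \<in> V \<Longrightarrow> card {e \<in> E. v \<in> ends e} = 2"
    using reg by (auto simp: two_regular_graph_def)
  have inc: "(Inl v, Inr e) \<in> incidence_order V E ends \<longleftrightarrow> v \<in> V \<and> e \<in> E \<and> v \<in> ends e" for v e
    by (auto simp: incidence_order_def)
  have inj: "f x = f y \<Longrightarrow> x = y" if "x \<in> A" "y \<in> A" for x y
    using f that by (auto simp: bij_betw_def inj_on_def)
  have surj: "\<exists>x\<in>A. f x = z" if "z \<in> V <+> E" for z
    using f that unfolding bij_betw_def by (metis imageE)
  have f_L: "\<exists>v\<in>V. f l = Inl v" if "l \<in> L" for l
  proof (rule ccontr)
    assume no: "\<not> (\<exists>v\<in>V. f l = Inl v)"
    have "f l \<in> V <+> E" using f that A by (auto simp: bij_betw_def)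
    with no obtain e where e: "e \<in> E" "f l = Inr e" by auto
    then have "ends e \<subseteq> V" "ends e \<noteq> {}" using graph[OF e(1)] by auto
    then obtain v where v: "v \<in> V" "v \<in> ends e" by blast
    then obtain x where x: "x \<in> A" "f x = Inl v" using surj[of "Inl v"] by auto
    then have "(x, l) \<in> r" using f_le[of x l] that A v e inc by auto
    moreover have "x \<noteq> l" using x e by auto
    ultimately have "l \<in> M" using strict[of x l] x that A by auto
    then show False using that A by auto
  qed
  have f_M: "\<exists>e\<in>E. f m = Inr e" if "m \<in> M" for m
  proof (rule ccontr)
    assume no: "\<not> (\<exists>e\<in>E. f m = Inr e)"
    have "f m \<in> V <+> E" using f that A by (auto simp: bij_betw_def)
    with no obtain v where v: "v \<in> V" "f m = Inl v" by auto
    then have "{e \<in> E. v \<in> ends e} \<noteq> {}" using deg[OF v(1)] by (metis card.empty zero_neq_numeral)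
    then obtain e where e: "e \<in> E" "v \<in> ends e" by blast
    then obtain x where x: "x \<in> A" "f x = Inr e" using surj[of "Inr e"] by auto
    then have "(m, x) \<in> r" using f_le[of m x] that A v e inc by auto
    moreover have "x \<noteq> m" using x v by auto
    ultimately have "m \<in> L" using strict[of m x] x that A by auto
    then show False using that A by auto
  qed
  have from_V: "\<exists>l\<in>L. f l = Inl v" if "v \<in> V" for v
    using surj[of "Inl v"] that f_M A by fastforce
  have from_E: "\<exists>m\<in>M. f m = Inr e" if "e \<in> E" for e
    using surj[of "Inr e"] that f_L A by fastforce
  show "card {m \<in> M. (l, m) \<in> r} = 2" if l: "l \<in> L" for l
  proof -
    obtain v where v: "v \<in> V" "f l = Inl v" using f_L[OF l] by blast
    have "bij_betw f {m \<in> M. (l, m) \<in> r} (Inr ` {e \<in> E. v \<in> ends e})"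
    proof (rule bij_betwI')
      show "f x = f y \<longleftrightarrow> x = y" if "x \<in> {m \<in> M. (l, m) \<in> r}" "y \<in> {m \<in> M. (l, m) \<in> r}" for x y
        using inj[of x y] that A by auto
      show "f x \<in> Inr ` {e \<in> E. v \<in> ends e}" if "x \<in> {m \<in> M. (l, m) \<in> r}" for x
        using f_M[of x] f_le[of l x] that A l v inc by auto
      show "\<exists>x\<in>{m \<in> M. (l, m) \<in> r}. y = f x" if y: "y \<in> Inr ` {e \<in> E. v \<in> ends e}" for y
      proof -
        obtain e where e: "e \<in> E" "v \<in> ends e" "y = Inr e" using y by auto
        then obtain m where m: "m \<in> M" "f m = Inr e" using from_E by blast
        then have "(l, m) \<in> r" using f_le[of l m] A l v e inc by auto
        then show ?thesis using m e by auto
      qed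
    qed
    then have "card {m \<in> M. (l, m) \<in> r} = card (Inr ` {e \<in> E. v \<in> ends e} :: ('a + 'a) set)"
      by (rule bij_betw_same_card)
    then show ?thesis using deg[OF v(1)] by (simp add: card_image)
  qed
  show "(l, l') \<in> {(a, b). a \<in> L \<and> b \<in> L \<and> (\<exists>m\<in>M. (a, m) \<in> r \<and> (b, m) \<in> r)}\<^sup>*" (is "_ \<in> ?R\<^sup>*")
    if l: "l \<in> L" "l' \<in> L" for l l'
  proof -
    obtain v v' where v: "v \<in> V" "f l = Inl v" "v' \<in> V" "f l' = Inl v'" using f_L l by metis
    have "(v, v') \<in> {(x, y). \<exists>e\<in>E. ends e = {x, y}}\<^sup>*"
      using conn v by (auto simp: connected_graph_def)
    then have "\<forall>l''\<in>L. f l'' = Inl v' \<longrightarrow> (l, l'') \<in> ?R\<^sup>*"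
    proof (induction rule: rtrancl_induct)
      case base
      show ?case
      proof (intro ballI impI)
        fix l'' assume "l'' \<in> L" "f l'' = Inl v"
        then have "l'' = l" using inj[of l'' l] l v A by auto
        then show "(l, l'') \<in> ?R\<^sup>*" by simp
      qed
    next
      case (step a b)
      then obtain e where e: "e \<in> E" "ends e = {a, b}" by auto
      then have "a \<in> V" "b \<in> V" using graph[OF e(1)] by auto
      obtain k m where k: "k \<in> L" "f k = Inl a" and m: "m \<in> M" "f m = Inr e"
        using from_V[OF \<open>a \<in> V\<close>] from_E[OF e(1)] by blast
      show ?case
      proof (intro ballI impI)
        fix l'' assume l'': "l'' \<in> L" "f l'' = Inl b"
        have "(k, m) \<in> r" "(l'', m) \<in> r"
          using f_le[of k m] f_le[of l'' m] A k m l'' e inc \<open>a \<in> V\<close> \<open>b \<in> V\<close> by auto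
        then have "(k, l'') \<in> ?R" using k l'' m by auto
        then show "(l, l'') \<in> ?R\<^sup>*" using step.IH k by (meson rtrancl.rtrancl_into_rtrancl)
      qed
    qed
    then show ?thesis using l v by blast
  qed
qed

lemma card_2_other:
  assumes "card A = 2" "a \<in> A"
  obtains b where "b \<in> A" "b \<noteq> a" "\<forall>c\<in>A. c \<noteq> a \<longrightarrow> c = b"
  using assms by (auto simp: card_2_iff)

section \<open>The automorphism group\<close>

lemma group_automorphism_group: "group (automorphism_group P)"
proof -
  interpret B: group "BijGroup (elems P)" by (rule group_BijGroup)
  let ?A = "{g \<in> Bij (elems P). \<forall>x\<in>elems P. \<forall>y\<in>elems P. (x, y) \<in> le P \<longleftrightarrow> (g x, g y) \<in> le P}"
  have "subgroup ?A (BijGroup (elems P))"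
  proof (rule B.subgroupI)
    show "?A \<subseteq> carrier (BijGroup (elems P))" by (auto simp: BijGroup_def)
    have "(\<lambda>x\<in>elems P. x) \<in> ?A" using id_Bij by auto
    then show "?A \<noteq> {}" by blast
  next
    fix g assume g: "g \<in> ?A"
    then have bij: "bij_betw g (elems P) (elems P)" by (simp add: Bij_def)
    have mem: "inv_into (elems P) g x \<in> elems P" "g (inv_into (elems P) g x) = x" if "x \<in> elems P" for x
      using Bij_inv_into_mem g that bij by (auto simp: bij_betw_def f_inv_into_f)
    have "(x, y) \<in> le P \<longleftrightarrow> (inv_into (elems P) g x, inv_into (elems P) g y) \<in> le P"
      if "x \<in> elems P" "y \<in> elems P" for x y
      using g mem that by force
    then show "inv\<^bsub>BijGroup (elems P)\<^esub> g \<in> ?A"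
      using g by (simp add: inv_BijGroup restrict_inv_into_Bij)
  next
    fix g h assume "g \<in> ?A" "h \<in> ?A"
    then show "g \<otimes>\<^bsub>BijGroup (elems P)\<^esub> h \<in> ?A"
      by (auto simp: BijGroup_def compose_Bij compose_eq Bij_imp_funcset[THEN funcset_mem])
  qed
  then show ?thesis
    unfolding automorphism_group_def by (rule B.subgroup_imp_group)
qed

lemma automorphism_group_carrier:
  "g \<in> carrier (automorphism_group P) \<longleftrightarrow>
    g \<in> Bij (elems P) \<and> (\<forall>x\<in>elems P. \<forall>y\<in>elems P. (x, y) \<in> le P \<longleftrightarrow> (g x, g y) \<in> le P)"
  by (simp add: automorphism_group_def)

lemma automorphism_group_mult:
  assumes "g \<in> carrier (automorphism_group P)" "h \<in> carrier (automorphism_group P)" "x \<in> elems P"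
  shows "(g \<otimes>\<^bsub>automorphism_group P\<^esub> h) x = g (h x)"
  using assms by (simp add: automorphism_group_def BijGroup_def compose_eq)

lemma automorphism_group_one: "x \<in> elems P \<Longrightarrow> \<one>\<^bsub>automorphism_group P\<^esub> x = x"
  by (simp add: automorphism_group_def BijGroup_def)

text \<open>Elements of \<open>Bij\<close> are extensional, so agreement on \<open>elems P\<close>
  is equality.\<close>

lemma automorphism_group_eqI:
  assumes "g \<in> carrier (automorphism_group P)" "h \<in> carrier (automorphism_group P)"
    and "\<And>x. x \<in> elems P \<Longrightarrow> g x = h x"
  shows "g = h"
  using assms by (auto simp: automorphism_group_carrier Bij_def intro: extensionalityI)

section \<open>Flags and adjacency in a finite polyhedron\<close>

locale polyhedron_of_type =
  fixes P :: "'a ranked_poset" and p q :: nat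
  assumes polyhedron: "polyhedron P" and type: "has_type P p q" and finite_elems: "finite (elems P)"
begin

abbreviation le_P (infix "\<preceq>" 50) where "x \<preceq> y \<equiv> (x, y) \<in> le P"
abbreviation "V \<equiv> of_rank P 0"
abbreviation "E \<equiv> of_rank P 1"
abbreviation "F \<equiv> of_rank P 2"
abbreviation "\<Gamma> \<equiv> automorphism_group P"
abbreviation "adj i \<Psi> \<equiv> adjacent_flag P \<Psi> i"

definition is_flag :: "'a \<Rightarrow> 'a \<Rightarrow> 'a \<Rightarrow> bool" where
  "is_flag v e f \<longleftrightarrow> v \<in> V \<and> e \<in> E \<and> f \<in> F \<and> v \<preceq> e \<and> e \<preceq> f"

lemma rank_less: "x \<preceq> y \<Longrightarrow> x \<noteq> y \<Longrightarrow> rank P x < rank P y"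
  and rank_le_2: "x \<in> elems P \<Longrightarrow> rank P x \<le> 2"
  and le_refl: "x \<in> elems P \<Longrightarrow> x \<preceq> x"
  and le_trans: "x \<preceq> y \<Longrightarrow> y \<preceq> z \<Longrightarrow> x \<preceq> z"
  and le_elems: "x \<preceq> y \<Longrightarrow> x \<in> elems P" "x \<preceq> y \<Longrightarrow> y \<in> elems P"
proof -
  have po: "partial_order_on (elems P) (le P)"
    and rk: "\<forall>x\<in>elems P. rank P x \<in> {0, 1, 2}"
    and lt: "\<forall>x y. x \<preceq> y \<and> x \<noteq> y \<longrightarrow> rank P x < rank P y"
    using polyhedron unfolding polyhedron_def by blast+
  show "x \<preceq> y \<Longrightarrow> x \<noteq> y \<Longrightarrow> rank P x < rank P y" using lt by blast
  show "x \<in> elems P \<Longrightarrow> rank P x \<le> 2" using rk by fastforce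
  show "x \<in> elems P \<Longrightarrow> x \<preceq> x" using partial_order_onD(1)[OF po] by (simp add: refl_on_def)
  show "x \<preceq> y \<Longrightarrow> y \<preceq> z \<Longrightarrow> x \<preceq> z" using partial_order_onD(2)[OF po] by (rule transD)
  show "x \<preceq> y \<Longrightarrow> x \<in> elems P" "x \<preceq> y \<Longrightarrow> y \<in> elems P" using partial_order_onD(4)[OF po] by auto
qed

lemma le_same_rank: "x \<preceq> y \<Longrightarrow> rank P x = rank P y \<Longrightarrow> x = y"
  using rank_less by fastforce

lemma of_rankD: "x \<in> of_rank P i \<Longrightarrow> x \<in> elems P" "x \<in> of_rank P i \<Longrightarrow> rank P x = i"
  by (simp_all add: of_rank_def)

lemma is_flagD:
  assumes "is_flag v e f"
  shows "v \<in> V" "e \<in> E" "f \<in> F" "v \<preceq> e" "e \<preceq> f" "v \<preceq> f"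
    "v \<in> elems P" "e \<in> elems P" "f \<in> elems P" "rank P v = 0" "rank P e = 1" "rank P f = 2"
  using assms le_trans[of v e f] by (auto simp: is_flag_def of_rank_def)

text \<open>Maximality: a chain containing \<open>v\<close>, \<open>e\<close> and \<open>f\<close>
  already has an element of each rank, and comparable elements of equal rank coincide.\<close>

lemma is_flag_in_flags:
  assumes "is_flag v e f" shows "{v, e, f} \<in> flags P"
proof -
  note F = is_flagD[OF assms]
  have "{v, e, f} \<in> Chains (le P)"
    using F le_refl by (auto simp: Chains_def)
  moreover have "D = {v, e, f}" if D: "D \<in> Chains (le P)" "{v, e, f} \<subseteq> D" for D
  proof
    show "D \<subseteq> {v, e, f}"
    proof
      fix x assume x: "x \<in> D"
      then have "x \<in> elems P" using D(1) le_elems by (force simp: Chains_def)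
      then have "rank P x = rank P v \<or> rank P x = rank P e \<or> rank P x = rank P f"
        using rank_le_2[of x] F by force
      then obtain y where y: "y \<in> {v, e, f}" "rank P x = rank P y" by blast
      then have "x \<preceq> y \<or> y \<preceq> x" using D x by (auto simp: Chains_def)
      then have "x = y" using y(2) le_same_rank by metis
      then show "x \<in> {v, e, f}" using y by simp
    qed
  qed (use D in simp)
  ultimately show ?thesis unfolding flags_def by blast
qed

lemma flags_E:
  assumes "\<Psi> \<in> flags P"
  obtains v e f where "is_flag v e f" "\<Psi> = {v, e, f}"
proof -
  have "\<forall>C\<in>flags P. \<exists>v\<in>V. \<exists>e\<in>E. \<exists>f\<in>F. C = {v, e, f}"
    using polyhedron unfolding polyhedron_def by blast
  from bspec[OF this assms] obtain v e f where vef: "v \<in> V" "e \<in> E" "f \<in> F" "\<Psi> = {v, e, f}"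
    by blast
  have "\<Psi> \<in> Chains (le P)" using assms by (simp add: flags_def)
  then have "v \<preceq> e \<or> e \<preceq> v" "e \<preceq> f \<or> f \<preceq> e" using vef by (auto simp: Chains_def)
  moreover have "rank P v = 0" "rank P e = 1" "rank P f = 2" using vef by (simp_all add: of_rank_def)
  ultimately have "v \<preceq> e" "e \<preceq> f" using rank_less[of e v] rank_less[of f e] by auto
  then show thesis using that vef by (simp add: is_flag_def)
qed

lemma flag_eq_iff:
  assumes "is_flag v e f" "is_flag v' e' f'"
  shows "{v, e, f} = {v', e', f'} \<longleftrightarrow> v = v' \<and> e = e' \<and> f = f'"
proof
  have level: "{x \<in> {v, e, f}. rank P x = 0} = {v}" "{x \<in> {v, e, f}. rank P x = 1} = {e}"
    "{x \<in> {v, e, f}. rank P x = 2} = {f}" if "is_flag v e f" for v e f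
    using is_flagD(10-12)[OF that] by auto
  assume "{v, e, f} = {v', e', f'}"
  then show "v = v' \<and> e = e' \<and> f = f'"
    using level[OF assms(1)] level[OF assms(2)] by (metis singleton_inject)
qed auto

lemma edge_ends: "e \<in> E \<Longrightarrow> card {v \<in> V. v \<preceq> e} = 2" "e \<in> E \<Longrightarrow> card {f \<in> F. e \<preceq> f} = 2"
  and face_edges: "f \<in> F \<Longrightarrow> card {e \<in> E. e \<preceq> f} = p"
  and vertex_edges: "v \<in> V \<Longrightarrow> card {e \<in> E. v \<preceq> e} = q"
  using polyhedron type unfolding polyhedron_def has_type_def by blast+

lemma vertex_section:
  assumes v: "v \<in> V"
  shows "\<And>e e'. e \<in> E \<Longrightarrow> v \<preceq> e \<Longrightarrow> e' \<in> E \<Longrightarrow> v \<preceq> e' \<Longrightarrow>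
    (e, e') \<in> {(a, b). a \<in> E \<and> v \<preceq> a \<and> b \<in> E \<and> v \<preceq> b \<and> (\<exists>f\<in>F. a \<preceq> f \<and> b \<preceq> f)}\<^sup>*"
proof -
  let ?A = "{x. v \<preceq> x \<and> x \<noteq> v}" and ?L = "{e \<in> E. v \<preceq> e}" and ?M = "{f \<in> F. v \<preceq> f}"
  have poly: "polygonal ?A (le P)"
    using polyhedron v unfolding polyhedron_def by blast
  have rk: "x \<in> ?A \<Longrightarrow> rank P x = 1 \<or> rank P x = 2" for x
    using rank_less[of v x] rank_le_2[of x] le_elems of_rankD(2)[OF v] by fastforce
  have A: "?A = ?L \<union> ?M" "?L \<inter> ?M = {}"
    using rk le_elems v by (auto simp: of_rank_def)
  have strict: "x \<in> ?L \<and> y \<in> ?M" if "x \<in> ?A" "y \<in> ?A" "x \<preceq> y" "x \<noteq> y" for x y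
    using rank_less[OF that(3,4)] rk[OF that(1)] rk[OF that(2)] le_elems that by (auto simp: of_rank_def)
  have mono: "{(a, b). a \<in> ?L \<and> b \<in> ?L \<and> (\<exists>m\<in>?M. a \<preceq> m \<and> b \<preceq> m)} \<subseteq>
    {(a, b). a \<in> E \<and> v \<preceq> a \<and> b \<in> E \<and> v \<preceq> b \<and> (\<exists>f\<in>F. a \<preceq> f \<and> b \<preceq> f)}" by blast
  fix e e' assume "e \<in> E" "v \<preceq> e" "e' \<in> E" "v \<preceq> e'"
  then have "(e, e') \<in> {(a, b). a \<in> ?L \<and> b \<in> ?L \<and> (\<exists>m\<in>?M. a \<preceq> m \<and> b \<preceq> m)}\<^sup>*"
    by (intro two_level_polygonal(2)[OF poly A strict]) auto
  then show "(e, e') \<in> {(a, b). a \<in> E \<and> v \<preceq> a \<and> b \<in> E \<and> v \<preceq> b \<and> (\<exists>f\<in>F. a \<preceq> f \<and> b \<preceq> f)}\<^sup>*"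
    using rtrancl_mono[OF mono] by blast
qed

text \<open>The first claim is the diamond condition for edges between a vertex and a face; it is
  the 2-regularity of the polygon below \<open>f\<close>.\<close>

lemma face_section:
  assumes f: "f \<in> F"
  shows "\<And>v. v \<in> V \<Longrightarrow> v \<preceq> f \<Longrightarrow> card {e \<in> E. v \<preceq> e \<and> e \<preceq> f} = 2"
    and "\<And>v v'. v \<in> V \<Longrightarrow> v \<preceq> f \<Longrightarrow> v' \<in> V \<Longrightarrow> v' \<preceq> f \<Longrightarrow>
      (v, v') \<in> {(a, b). a \<in> V \<and> b \<in> V \<and> (\<exists>e\<in>E. e \<preceq> f \<and> a \<preceq> e \<and> b \<preceq> e)}\<^sup>*"
proof -
  let ?A = "{x. x \<preceq> f \<and> x \<noteq> f}" and ?L = "{v \<in> V. v \<preceq> f}" and ?M = "{e \<in> E. e \<preceq> f}"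
  have poly: "polygonal ?A (le P)"
    using polyhedron f unfolding polyhedron_def by blast
  have rk: "x \<in> ?A \<Longrightarrow> rank P x = 0 \<or> rank P x = 1" for x
    using rank_less[of x f] of_rankD(2)[OF f] by fastforce
  have A: "?A = ?L \<union> ?M" "?L \<inter> ?M = {}"
    using rk le_elems f by (auto simp: of_rank_def)
  have strict: "x \<in> ?L \<and> y \<in> ?M" if "x \<in> ?A" "y \<in> ?A" "x \<preceq> y" "x \<noteq> y" for x y
    using rank_less[OF that(3,4)] rk[OF that(1)] rk[OF that(2)] le_elems that by (auto simp: of_rank_def)
  show "card {e \<in> E. v \<preceq> e \<and> e \<preceq> f} = 2" if "v \<in> V" "v \<preceq> f" for v
  proof -
    have "card {e \<in> ?M. v \<preceq> e} = 2"
      by (rule two_level_polygonal(1)[OF poly A strict]) (use that in auto)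
    moreover have "{e \<in> ?M. v \<preceq> e} = {e \<in> E. v \<preceq> e \<and> e \<preceq> f}" by blast
    ultimately show ?thesis by simp
  qed
  have mono: "{(a, b). a \<in> ?L \<and> b \<in> ?L \<and> (\<exists>m\<in>?M. a \<preceq> m \<and> b \<preceq> m)} \<subseteq>
    {(a, b). a \<in> V \<and> b \<in> V \<and> (\<exists>e\<in>E. e \<preceq> f \<and> a \<preceq> e \<and> b \<preceq> e)}" by blast
  fix v v' assume "v \<in> V" "v \<preceq> f" "v' \<in> V" "v' \<preceq> f"
  then have "(v, v') \<in> {(a, b). a \<in> ?L \<and> b \<in> ?L \<and> (\<exists>m\<in>?M. a \<preceq> m \<and> b \<preceq> m)}\<^sup>*"
    by (intro two_level_polygonal(2)[OF poly A strict]) auto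
  then show "(v, v') \<in> {(a, b). a \<in> V \<and> b \<in> V \<and> (\<exists>e\<in>E. e \<preceq> f \<and> a \<preceq> e \<and> b \<preceq> e)}\<^sup>*"
    using rtrancl_mono[OF mono] by blast
qed

text \<open>Relational counterpart of \<open>adjacent_flag\<close>: existence and uniqueness are
  proved for it before the definite description is evaluated.\<close>

definition adjacent :: "nat \<Rightarrow> 'a set \<Rightarrow> 'a set \<Rightarrow> bool" where
  "adjacent i \<Psi> \<Psi>' \<longleftrightarrow> \<Psi> \<in> flags P \<and> \<Psi>' \<in> flags P \<and> \<Psi>' \<noteq> \<Psi> \<and>
     {x \<in> \<Psi>'. rank P x \<noteq> i} = {x \<in> \<Psi>. rank P x \<noteq> i}"

lemma adjacent_sym: "adjacent i \<Psi> \<Psi>' \<Longrightarrow> adjacent i \<Psi>' \<Psi>"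
  by (auto simp: adjacent_def)

lemma adjacent_iff:
  assumes "is_flag v e f" "is_flag v' e' f'"
  shows "adjacent 0 {v, e, f} {v', e', f'} \<longleftrightarrow> v' \<noteq> v \<and> e' = e \<and> f' = f"
    and "adjacent 1 {v, e, f} {v', e', f'} \<longleftrightarrow> v' = v \<and> e' \<noteq> e \<and> f' = f"
    and "adjacent 2 {v, e, f} {v', e', f'} \<longleftrightarrow> v' = v \<and> e' = e \<and> f' \<noteq> f"
proof -
  note F = is_flagD[OF assms(1)] and F' = is_flagD[OF assms(2)]
  have restr: "{x \<in> {v, e, f}. rank P x \<noteq> i} =
      (if i = 0 then {e, f} else if i = 1 then {v, f} else if i = 2 then {v, e} else {v, e, f})"
    "{x \<in> {v', e', f'}. rank P x \<noteq> i} =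
      (if i = 0 then {e', f'} else if i = 1 then {v', f'} else if i = 2 then {v', e'} else {v', e', f'})" for i
    using F F' by auto
  have ne: "v \<noteq> e'" "v \<noteq> f'" "e \<noteq> v'" "e \<noteq> f'" "f \<noteq> v'" "f \<noteq> e'" using F F' by auto
  show "adjacent 0 {v, e, f} {v', e', f'} \<longleftrightarrow> v' \<noteq> v \<and> e' = e \<and> f' = f"
    "adjacent 1 {v, e, f} {v', e', f'} \<longleftrightarrow> v' = v \<and> e' \<noteq> e \<and> f' = f"
    "adjacent 2 {v, e, f} {v', e', f'} \<longleftrightarrow> v' = v \<and> e' = e \<and> f' \<noteq> f"
    unfolding adjacent_def restr flag_eq_iff[OF assms(2,1)]
    using is_flag_in_flags[OF assms(1)] is_flag_in_flags[OF assms(2)] ne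
    by (auto simp: doubleton_eq_iff)
qed

text \<open>With the other two elements fixed there are exactly two choices at each rank: the ends
  of \<open>e\<close>, the edges between \<open>v\<close> and \<open>f\<close>, the faces at
  \<open>e\<close>.\<close>

lemma adjacent_ex1:
  assumes "\<Psi> \<in> flags P" "i \<le> 2" shows "\<exists>!\<Psi>'. adjacent i \<Psi> \<Psi>'"
proof -
  obtain v e f where vef: "is_flag v e f" "\<Psi> = {v, e, f}" by (rule flags_E[OF assms(1)])
  note F = is_flagD[OF vef(1)]
  consider (1) "i = 0" | (2) "i = 1" | (3) "i = 2" using assms by linarith
  then show ?thesis
  proof cases
    case 1
    from edge_ends(1)[OF F(2)] obtain w where w: "w \<in> {v \<in> V. v \<preceq> e}" "w \<noteq> v"
        "\<forall>c\<in>{v \<in> V. v \<preceq> e}. c \<noteq> v \<longrightarrow> c = w"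
      by (rule card_2_other) (use F in auto)
    have fl: "is_flag w e f" using w(1) F by (simp add: is_flag_def)
    show ?thesis
    proof (rule ex1I)
      show "adjacent i \<Psi> {w, e, f}"
        using w(2) by (simp add: vef(2) 1 adjacent_iff(1)[OF vef(1) fl])
      fix \<Psi>' assume adj: "adjacent i \<Psi> \<Psi>'"
      then have "\<Psi>' \<in> flags P" by (simp add: adjacent_def)
      then obtain v' e' f' where fl': "is_flag v' e' f'" and \<Psi>': "\<Psi>' = {v', e', f'}"
        by (rule flags_E)
      then have eq: "v' \<noteq> v \<and> e' = e \<and> f' = f"
        using adj adjacent_iff(1)[OF vef(1) fl'] by (simp add: vef(2) 1)
      then have "v' = w" using w(3) is_flagD[OF fl'] by simp
      with eq show "\<Psi>' = {w, e, f}" by (simp add: \<Psi>')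
    qed
  next
    case 2
    from face_section(1)[OF F(3) F(1) F(6)] obtain w where w: "w \<in> {e \<in> E. v \<preceq> e \<and> e \<preceq> f}" "w \<noteq> e"
        "\<forall>c\<in>{e \<in> E. v \<preceq> e \<and> e \<preceq> f}. c \<noteq> e \<longrightarrow> c = w"
      by (rule card_2_other) (use F in auto)
    have fl: "is_flag v w f" using w(1) F by (simp add: is_flag_def)
    show ?thesis
    proof (rule ex1I)
      show "adjacent i \<Psi> {v, w, f}"
        using w(2) by (simp add: vef(2) 2 adjacent_iff(2)[OF vef(1) fl] del: One_nat_def)
      fix \<Psi>' assume adj: "adjacent i \<Psi> \<Psi>'"
      then have "\<Psi>' \<in> flags P" by (simp add: adjacent_def)
      then obtain v' e' f' where fl': "is_flag v' e' f'" and \<Psi>': "\<Psi>' = {v', e', f'}"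
        by (rule flags_E)
      then have eq: "v' = v \<and> e' \<noteq> e \<and> f' = f"
        using adj adjacent_iff(2)[OF vef(1) fl'] by (simp add: vef(2) 2 del: One_nat_def)
      then have "e' = w" using w(3) is_flagD[OF fl'] by simp
      with eq show "\<Psi>' = {v, w, f}" by (simp add: \<Psi>')
    qed
  next
    case 3
    from edge_ends(2)[OF F(2)] obtain w where w: "w \<in> {f \<in> F. e \<preceq> f}" "w \<noteq> f"
        "\<forall>c\<in>{f \<in> F. e \<preceq> f}. c \<noteq> f \<longrightarrow> c = w"
      by (rule card_2_other) (use F in auto)
    have fl: "is_flag v e w" using w(1) F by (simp add: is_flag_def)
    show ?thesis
    proof (rule ex1I)
      show "adjacent i \<Psi> {v, e, w}"
        using w(2) by (simp add: vef(2) 3 adjacent_iff(3)[OF vef(1) fl])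
      fix \<Psi>' assume adj: "adjacent i \<Psi> \<Psi>'"
      then have "\<Psi>' \<in> flags P" by (simp add: adjacent_def)
      then obtain v' e' f' where fl': "is_flag v' e' f'" and \<Psi>': "\<Psi>' = {v', e', f'}"
        by (rule flags_E)
      then have eq: "v' = v \<and> e' = e \<and> f' \<noteq> f"
        using adj adjacent_iff(3)[OF vef(1) fl'] by (simp add: vef(2) 3)
      then have "f' = w" using w(3) is_flagD[OF fl'] by simp
      with eq show "\<Psi>' = {v, e, w}" by (simp add: \<Psi>')
    qed
  qed
qed

lemma adj_eq_iff:
  assumes "\<Psi> \<in> flags P" "i \<le> 2"
  shows "adjacent i \<Psi> \<Psi>' \<longleftrightarrow> \<Psi>' = adj i \<Psi>"
proof -
  have "adj i \<Psi> = (THE \<Psi>'. adjacent i \<Psi> \<Psi>')"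
    using assms by (simp add: adjacent_flag_def adjacent_def)
  then show ?thesis using adjacent_ex1[OF assms] by (metis theI')
qed

lemma adj_flag: "\<Psi> \<in> flags P \<Longrightarrow> i \<le> 2 \<Longrightarrow> adj i \<Psi> \<in> flags P"
  using adj_eq_iff[of \<Psi> i "adj i \<Psi>"] by (simp add: adjacent_def)

lemma adj_adj: "\<Psi> \<in> flags P \<Longrightarrow> i \<le> 2 \<Longrightarrow> adj i (adj i \<Psi>) = \<Psi>"
  using adj_eq_iff[of \<Psi> i "adj i \<Psi>"] adj_eq_iff[of "adj i \<Psi>" i \<Psi>] adjacent_sym adj_flag by blast

lemma is_flag_adj:
  assumes "is_flag v e f"
  shows "\<exists>v'. is_flag v' e f \<and> adj 0 {v, e, f} = {v', e, f}"
    and "\<exists>e'. is_flag v e' f \<and> adj 1 {v, e, f} = {v, e', f}"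
    and "\<exists>f'. is_flag v e f' \<and> adj 2 {v, e, f} = {v, e, f'}"
proof -
  have fl: "{v, e, f} \<in> flags P" using assms by (rule is_flag_in_flags)
  have ex: "\<exists>v' e' f'. is_flag v' e' f' \<and> adj i {v, e, f} = {v', e', f'} \<and> adjacent i {v, e, f} {v', e', f'}"
    if "i \<le> 2" for i
    using flags_E[OF adj_flag[OF fl that]] adj_eq_iff[OF fl that] by metis
  show "\<exists>v'. is_flag v' e f \<and> adj 0 {v, e, f} = {v', e, f}"
    using ex[of 0] adjacent_iff(1)[OF assms] by auto
  show "\<exists>e'. is_flag v e' f \<and> adj 1 {v, e, f} = {v, e', f}"
    using ex[of 1] adjacent_iff(2)[OF assms] by auto
  show "\<exists>f'. is_flag v e f' \<and> adj 2 {v, e, f} = {v, e, f'}"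
    using ex[of 2] adjacent_iff(3)[OF assms] by auto
qed

lemma is_flag_adjI:
  assumes "is_flag v e f" "is_flag v' e' f'"
  shows "v' \<noteq> v \<Longrightarrow> e' = e \<Longrightarrow> f' = f \<Longrightarrow> adj 0 {v, e, f} = {v', e', f'}"
    and "v' = v \<Longrightarrow> e' \<noteq> e \<Longrightarrow> f' = f \<Longrightarrow> adj 1 {v, e, f} = {v', e', f'}"
    and "v' = v \<Longrightarrow> e' = e \<Longrightarrow> f' \<noteq> f \<Longrightarrow> adj 2 {v, e, f} = {v', e', f'}"
  using adjacent_iff[OF assms] adj_eq_iff[OF is_flag_in_flags[OF assms(1)]] by force+

text \<open>The vertex changes below and the face above one and the same edge, independently of each
  other. This becomes the commutation of \<open>\<rho> 0\<close> and
  \<open>\<rho> 2\<close>.\<close>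

lemma adj_commute:
  assumes "\<Psi> \<in> flags P" shows "adj 0 (adj 2 \<Psi>) = adj 2 (adj 0 \<Psi>)"
proof -
  obtain v e f where vef: "is_flag v e f" "\<Psi> = {v, e, f}" using assms by (rule flags_E)
  obtain v' where v': "is_flag v' e f" "adj 0 {v, e, f} = {v', e, f}" using is_flag_adj(1)[OF vef(1)] by blast
  obtain f' where f': "is_flag v e f'" "adj 2 {v, e, f} = {v, e, f'}" using is_flag_adj(3)[OF vef(1)] by blast
  have fl: "is_flag v' e f'" using v'(1) f'(1) by (simp add: is_flag_def)
  have "v' \<noteq> v" "f' \<noteq> f"
    using adj_eq_iff[OF is_flag_in_flags[OF vef(1)], of 0] adjacent_iff(1)[OF vef(1) v'(1)]
      adj_eq_iff[OF is_flag_in_flags[OF vef(1)], of 2] adjacent_iff(3)[OF vef(1) f'(1)] v' f' by auto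
  then show ?thesis
    using is_flag_adjI(1)[OF f'(1) fl] is_flag_adjI(3)[OF v'(1) fl] by (simp add: vef v' f')
qed

text \<open>Connectedness of the face as a closure principle: the walk goes from vertex to vertex of
  \<open>f\<close> through common edges, and each change of vertex or edge is an adjacency under
  which \<open>T\<close> is closed.\<close>

lemma flags_of_face_connected:
  assumes closed: "\<And>\<Psi>. \<Psi> \<in> T \<Longrightarrow> adj 0 \<Psi> \<in> T" "\<And>\<Psi>. \<Psi> \<in> T \<Longrightarrow> adj 1 \<Psi> \<in> T"
    and start: "{v, e, f} \<in> T" "is_flag v e f" and fl: "is_flag v' e' f"
  shows "{v', e', f} \<in> T"
proof -
  have step1: "{v, e', f} \<in> T" if "{v, e, f} \<in> T" "is_flag v e f" "is_flag v e' f" for v e e'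
    using closed(2)[OF that(1)] is_flag_adjI(2)[OF that(2,3)] that(1) by (cases "e' = e") auto
  have step0: "{v', e, f} \<in> T" if "{v, e, f} \<in> T" "is_flag v e f" "is_flag v' e f" for v v' e
    using closed(1)[OF that(1)] is_flag_adjI(1)[OF that(2,3)] that(1) by (cases "v' = v") auto
  note S = is_flagD[OF start(2)] and F = is_flagD[OF fl]
  \<comment> \<open>Claimed for all edges of the face at the current vertex, since the edge by which
    a vertex is reached need not be the one by which it is left.\<close>
  have "\<forall>e'. is_flag v' e' f \<longrightarrow> {v', e', f} \<in> T"
    using face_section(2)[OF S(3) S(1) S(6) F(1) F(6)]
  proof (induction rule: rtrancl_induct)
    case base
    then show ?case using step1 start by blast
  next
    case (step a b)
    then obtain m where m: "is_flag a m f" "is_flag b m f"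
      using S(3) by (auto simp: is_flag_def)
    then have "{b, m, f} \<in> T" using step0 step.IH by blast
    then show ?case using step1 m by blast
  qed
  then show ?thesis using fl by blast
qed

lemma flags_of_vertex_connected:
  assumes closed: "\<And>\<Psi>. \<Psi> \<in> T \<Longrightarrow> adj 1 \<Psi> \<in> T" "\<And>\<Psi>. \<Psi> \<in> T \<Longrightarrow> adj 2 \<Psi> \<in> T"
    and start: "{v, e, f} \<in> T" "is_flag v e f" and fl: "is_flag v e' f'"
  shows "{v, e', f'} \<in> T"
proof -
  have step1: "{v, e', f} \<in> T" if "{v, e, f} \<in> T" "is_flag v e f" "is_flag v e' f" for e e' f
    using closed(1)[OF that(1)] is_flag_adjI(2)[OF that(2,3)] that(1) by (cases "e' = e") auto
  have step2: "{v, e, f'} \<in> T" if "{v, e, f} \<in> T" "is_flag v e f" "is_flag v e f'" for e f f'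
    using closed(2)[OF that(1)] is_flag_adjI(3)[OF that(2,3)] that(1) by (cases "f' = f") auto
  note S = is_flagD[OF start(2)] and F = is_flagD[OF fl]
  have "\<forall>f'. is_flag v e' f' \<longrightarrow> {v, e', f'} \<in> T"
    using vertex_section[OF S(1) S(2) S(4) F(2) F(4)]
  proof (induction rule: rtrancl_induct)
    case base
    then show ?case using step2 start by blast
  next
    case (step a b)
    then obtain m where m: "is_flag v a m" "is_flag v b m"
      using S(1) by (auto simp: is_flag_def)
    then have "{v, b, m} \<in> T" using step1 step.IH by blast
    then show ?case using step2 m by blast
  qed
  then show ?thesis using fl by blast
qed

section \<open>Counting flags and vertices\<close>

lemma finite_of_rank [simp]: "finite (of_rank P i)"
  using finite_elems by (simp add: of_rank_def)

lemma flags_subset_elems: "\<Psi> \<in> flags P \<Longrightarrow> \<Psi> \<subseteq> elems P"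
  by (auto elim!: flags_E dest: is_flagD)

lemma card_flags_of_face:
  assumes "f \<in> F" shows "card {\<Psi> \<in> flags P. f \<in> \<Psi>} = 2 * p"
proof -
  let ?S = "SIGMA e:{e \<in> E. e \<preceq> f}. {v \<in> V. v \<preceq> e}"
  have fl: "is_flag v e f" if "(e, v) \<in> ?S" for e v using that assms by (simp add: is_flag_def)
  have inj: "inj_on (\<lambda>(e, v). {v, e, f}) ?S"
    by (rule inj_onI) (use fl flag_eq_iff in fastforce)
  have img: "(\<lambda>(e, v). {v, e, f}) ` ?S = {\<Psi> \<in> flags P. f \<in> \<Psi>}"
  proof (rule antisym; rule subsetI)
    fix \<Psi> assume "\<Psi> \<in> {\<Psi> \<in> flags P. f \<in> \<Psi>}"
    then obtain v e f' where vef: "is_flag v e f'" "\<Psi> = {v, e, f'}" "f \<in> \<Psi>" by (auto elim: flags_E)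
    then have "f' = f" using is_flagD[OF vef(1)] of_rankD(2)[OF assms] by auto
    then show "\<Psi> \<in> (\<lambda>(e, v). {v, e, f}) ` ?S"
      using vef is_flagD[OF vef(1)] by (intro image_eqI[of _ _ "(e, v)"]) auto
  qed (use is_flag_in_flags fl in auto)
  have "card {\<Psi> \<in> flags P. f \<in> \<Psi>} = card ?S"
    unfolding img[symmetric] by (rule card_image[OF inj])
  also have "\<dots> = (\<Sum>e\<in>{e \<in> E. e \<preceq> f}. card {v \<in> V. v \<preceq> e})" by (rule card_SigmaI) auto
  also have "\<dots> = 2 * p" using face_edges[OF assms] edge_ends(1) by simp
  finally show ?thesis .
qed

lemma card_flags_of_vertex:
  assumes "v \<in> V" shows "card {\<Psi> \<in> flags P. v \<in> \<Psi>} = 2 * q"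
proof -
  let ?S = "SIGMA e:{e \<in> E. v \<preceq> e}. {f \<in> F. e \<preceq> f}"
  have fl: "is_flag v e f" if "(e, f) \<in> ?S" for e f using that assms by (simp add: is_flag_def)
  have inj: "inj_on (\<lambda>(e, f). {v, e, f}) ?S"
    by (rule inj_onI) (use fl flag_eq_iff in fastforce)
  have img: "(\<lambda>(e, f). {v, e, f}) ` ?S = {\<Psi> \<in> flags P. v \<in> \<Psi>}"
  proof (rule antisym; rule subsetI)
    fix \<Psi> assume "\<Psi> \<in> {\<Psi> \<in> flags P. v \<in> \<Psi>}"
    then obtain v' e f where vef: "is_flag v' e f" "\<Psi> = {v', e, f}" "v \<in> \<Psi>" by (auto elim: flags_E)
    then have "v' = v" using is_flagD[OF vef(1)] of_rankD(2)[OF assms] by auto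
    then show "\<Psi> \<in> (\<lambda>(e, f). {v, e, f}) ` ?S"
      using vef is_flagD[OF vef(1)] by (intro image_eqI[of _ _ "(e, f)"]) auto
  qed (use is_flag_in_flags fl in auto)
  have "card {\<Psi> \<in> flags P. v \<in> \<Psi>} = card ?S"
    unfolding img[symmetric] by (rule card_image[OF inj])
  also have "\<dots> = (\<Sum>e\<in>{e \<in> E. v \<preceq> e}. card {f \<in> F. e \<preceq> f})" by (rule card_SigmaI) auto
  also have "\<dots> = 2 * q" using vertex_edges[OF assms] edge_ends(2) by simp
  finally show ?thesis .
qed

lemma card_flags: "card (flags P) = card V * (2 * q)"
proof -
  have "\<exists>v\<in>V. v \<in> \<Psi>" if "\<Psi> \<in> flags P" for \<Psi>
    using that by (rule flags_E) (auto dest: is_flagD(1))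
  then have "flags P = (\<Union>v\<in>V. {\<Psi> \<in> flags P. v \<in> \<Psi>})" by blast
  moreover have "card (\<Union>v\<in>V. {\<Psi> \<in> flags P. v \<in> \<Psi>}) = (\<Sum>v\<in>V. card {\<Psi> \<in> flags P. v \<in> \<Psi>})"
  proof (rule card_UN_disjoint)
    have "finite (flags P)"
      using flags_subset_elems finite_elems by (intro finite_subset[of "flags P" "Pow (elems P)"]) auto
    then show "\<forall>v\<in>V. finite {\<Psi> \<in> flags P. v \<in> \<Psi>}" by simp
    show "\<forall>v\<in>V. \<forall>w\<in>V. v \<noteq> w \<longrightarrow> {\<Psi> \<in> flags P. v \<in> \<Psi>} \<inter> {\<Psi> \<in> flags P. w \<in> \<Psi>} = {}"
      by (auto simp: of_rank_def elim!: flags_E dest: is_flagD)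
  qed simp
  ultimately show ?thesis using card_flags_of_vertex by simp
qed

text \<open>Double counting of incidences inside the face: each edge has two ends and each vertex
  lies on two of the edges.\<close>

lemma card_vertices_of_face:
  assumes "f \<in> F" shows "card {v \<in> V. v \<preceq> f} = p"
proof -
  have "(\<Sum>v\<in>{v \<in> V. v \<preceq> f}. card {e \<in> {e \<in> E. e \<preceq> f}. v \<preceq> e}) = 2 * card {e \<in> E. e \<preceq> f}"
  proof (rule sum_multicount)
    show "\<forall>e\<in>{e \<in> E. e \<preceq> f}. card {v \<in> {v \<in> V. v \<preceq> f}. v \<preceq> e} = 2"
    proof
      fix e assume e: "e \<in> {e \<in> E. e \<preceq> f}"
      then have "{v \<in> {v \<in> V. v \<preceq> f}. v \<preceq> e} = {v \<in> V. v \<preceq> e}" using le_trans by blast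
      then show "card {v \<in> {v \<in> V. v \<preceq> f}. v \<preceq> e} = 2" using edge_ends(1) e by simp
    qed
  qed simp_all
  moreover have "card {e \<in> {e \<in> E. e \<preceq> f}. v \<preceq> e} = 2" if "v \<in> {v \<in> V. v \<preceq> f}" for v
  proof -
    have "{e \<in> {e \<in> E. e \<preceq> f}. v \<preceq> e} = {e \<in> E. v \<preceq> e \<and> e \<preceq> f}" by blast
    then show ?thesis using face_section(1)[OF assms] that by simp
  qed
  ultimately show ?thesis using face_edges[OF assms] by simp
qed

end

section \<open>The action of the automorphism group on flags\<close>

declare One_nat_def [simp del]

context polyhedron_of_type
begin

lemma aut_elems: "g \<in> carrier \<Gamma> \<Longrightarrow> x \<in> elems P \<Longrightarrow> g x \<in> elems P"
  and aut_inj: "g \<in> carrier \<Gamma> \<Longrightarrow> x \<in> elems P \<Longrightarrow> y \<in> elems P \<Longrightarrow> g x = g y \<Longrightarrow> x = y"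
  by (auto simp: automorphism_group_carrier Bij_def bij_betw_def inj_on_def)

lemma aut_le: "g \<in> carrier \<Gamma> \<Longrightarrow> x \<preceq> y \<Longrightarrow> g x \<preceq> g y"
  using le_elems[of x y] by (simp add: automorphism_group_carrier)

text \<open>Automorphisms preserve only the order by definition. Ranks follow: they increase
  strictly along the image of a flag and are at most 2, so they are 0, 1, 2.\<close>

lemma aut_is_flag:
  assumes g: "g \<in> carrier \<Gamma>" and fl: "is_flag v e f"
  shows "is_flag (g v) (g e) (g f)"
proof -
  note F = is_flagD[OF fl]
  have "v \<noteq> e" "e \<noteq> f" using F by auto
  then have "rank P (g v) < rank P (g e)" "rank P (g e) < rank P (g f)"
    using rank_less[OF aut_le[OF g F(4)]] rank_less[OF aut_le[OF g F(5)]] aut_inj[OF g] F by blast+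
  moreover have "rank P (g f) \<le> 2" using rank_le_2 aut_elems[OF g F(9)] by simp
  ultimately have "rank P (g v) = 0" "rank P (g e) = 1" "rank P (g f) = 2" by linarith+
  then show ?thesis
    using aut_elems[OF g] aut_le[OF g] F by (simp add: is_flag_def of_rank_def)
qed

lemma aut_flags: "g \<in> carrier \<Gamma> \<Longrightarrow> \<Psi> \<in> flags P \<Longrightarrow> g ` \<Psi> \<in> flags P"
  by (erule flags_E) (use aut_is_flag is_flag_in_flags in fastforce)

lemma aut_adj:
  assumes g: "g \<in> carrier \<Gamma>" and \<Psi>: "\<Psi> \<in> flags P" and "i \<le> 2"
  shows "g ` adj i \<Psi> = adj i (g ` \<Psi>)"
proof -
  obtain v e f where fl: "is_flag v e f" and vef: "\<Psi> = {v, e, f}" by (rule flags_E[OF \<Psi>])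
  obtain v' e' f' where fl': "is_flag v' e' f'" and vef': "adj i \<Psi> = {v', e', f'}"
    by (rule flags_E[OF adj_flag[OF \<Psi> \<open>i \<le> 2\<close>]])
  have adj: "adjacent i {v, e, f} {v', e', f'}"
    using adj_eq_iff[OF \<Psi> \<open>i \<le> 2\<close>] vef vef' by simp
  have inj: "g a = g b \<longleftrightarrow> a = b" if "a \<in> elems P" "b \<in> elems P" for a b
    using aut_inj[OF g that] by blast
  note el = is_flagD(7-9)[OF fl] is_flagD(7-9)[OF fl']
  note gfl = aut_is_flag[OF g fl] aut_is_flag[OF g fl']
  have "adjacent i {g v, g e, g f} {g v', g e', g f'}"
  proof -
    consider (1) "i = 0" | (2) "i = 1" | (3) "i = 2" using assms by linarith
    then show ?thesis
    proof cases
      case 1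
      show ?thesis using adj unfolding 1 adjacent_iff(1)[OF fl fl'] adjacent_iff(1)[OF gfl]
        by (simp add: inj el)
    next
      case 2
      show ?thesis using adj unfolding 2 adjacent_iff(2)[OF fl fl'] adjacent_iff(2)[OF gfl]
        by (simp add: inj el)
    next
      case 3
      show ?thesis using adj unfolding 3 adjacent_iff(3)[OF fl fl'] adjacent_iff(3)[OF gfl]
        by (simp add: inj el)
    qed
  qed
  then show ?thesis
    using adj_eq_iff[OF aut_flags[OF g \<Psi>] \<open>i \<le> 2\<close>] unfolding vef' by (simp add: vef)
qed

lemma aut_mult_image:
  assumes "g \<in> carrier \<Gamma>" "h \<in> carrier \<Gamma>" "\<Psi> \<in> flags P"
  shows "(g \<otimes>\<^bsub>\<Gamma>\<^esub> h) ` \<Psi> = g ` h ` \<Psi>"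
  unfolding image_image using automorphism_group_mult[OF assms(1,2)] flags_subset_elems[OF assms(3)]
  by (intro image_cong) auto

lemma aut_one_image: "\<Psi> \<in> flags P \<Longrightarrow> \<one>\<^bsub>\<Gamma>\<^esub> ` \<Psi> = \<Psi>"
  using flags_subset_elems[of \<Psi>] automorphism_group_one[of _ P] by force

end

section \<open>Tight regular polyhedra\<close>

locale tight_regular_polyhedron = polyhedron_of_type +
  fixes \<Phi>
  assumes base_flag: "\<Phi> \<in> flags P" and card_flags_eq: "card (flags P) = 2 * p * q"
    and regular: "regular P"
begin

lemma p_ge_2: "2 \<le> p" and q_pos: "0 < q"
proof -
  obtain v e f where "is_flag v e f" by (rule flags_E[OF base_flag])
  note F = is_flagD[OF this]
  have "{e \<in> E. v \<preceq> e} \<noteq> {}" using F by blast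
  then have "card {e \<in> E. v \<preceq> e} \<noteq> 0" by (subst card_0_eq) auto
  then show "0 < q" using vertex_edges[OF F(1)] by simp
  have "card {e \<in> E. v \<preceq> e \<and> e \<preceq> f} \<le> card {e \<in> E. e \<preceq> f}"
    by (rule card_mono) auto
  then show "2 \<le> p" using face_section(1)[OF F(3) F(1) F(6)] face_edges[OF F(3)] by simp
qed

text \<open>Each vertex lies on \<open>2 * q\<close> flags, so \<open>2 * p * q\<close> flags mean
  \<open>p\<close> vertices in all, as many as a single face has.\<close>

lemma vertex_le_face:
  assumes "v \<in> V" "f \<in> F" shows "v \<preceq> f"
proof -
  have "card V * (2 * q) = p * (2 * q)"
    using card_flags card_flags_eq by auto
  then have "card V = card {v \<in> V. v \<preceq> f}"
    using q_pos card_vertices_of_face[OF assms(2)] by simp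
  then have "{v \<in> V. v \<preceq> f} = V"
    by (intro card_subset_eq) auto
  then show ?thesis using assms by blast
qed

lemma ex_flag_vertex_face:
  assumes "v \<in> V" "f \<in> F" obtains e where "is_flag v e f"
proof -
  have "card {e \<in> E. v \<preceq> e \<and> e \<preceq> f} = 2"
    using face_section(1)[OF assms(2,1) vertex_le_face[OF assms]] .
  then have "{e \<in> E. v \<preceq> e \<and> e \<preceq> f} \<noteq> {}" by (metis card.empty zero_neq_numeral)
  then show thesis using that assms by (auto simp: is_flag_def)
qed

text \<open>The vertex of any flag lies on the base face. So one can go around the base face to a
  flag at that vertex, and then around the vertex.\<close>

lemma flags_connected:
  assumes closed: "\<And>i \<Psi>. i \<le> 2 \<Longrightarrow> \<Psi> \<in> T \<Longrightarrow> adj i \<Psi> \<in> T"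
    and start: "\<Phi> \<in> T" and \<Psi>: "\<Psi> \<in> flags P"
  shows "\<Psi> \<in> T"
proof -
  obtain v0 e0 f0 where \<Phi>: "is_flag v0 e0 f0" "\<Phi> = {v0, e0, f0}" by (rule flags_E[OF base_flag])
  obtain v e f where vef: "is_flag v e f" "\<Psi> = {v, e, f}" by (rule flags_E[OF \<Psi>])
  obtain e' where e': "is_flag v e' f0"
    using ex_flag_vertex_face is_flagD(1)[OF vef(1)] is_flagD(3)[OF \<Phi>(1)] by metis
  have "{v, e', f0} \<in> T"
    by (rule flags_of_face_connected[OF _ _ _ \<Phi>(1) e']) (use closed start \<Phi> in auto)
  then have "{v, e, f} \<in> T"
    by (rule flags_of_vertex_connected[OF _ _ _ e' vef(1), rotated 2]) (use closed in auto)
  then show ?thesis using vef by simp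
qed

lemma elem_in_flag:
  assumes "x \<in> elems P" obtains v e f where "is_flag v e f" "x = v \<or> x = e \<or> x = f"
proof -
  obtain v0 e0 f0 where \<Phi>: "is_flag v0 e0 f0" by (rule flags_E[OF base_flag])
  have edge: "\<exists>v f. is_flag v e f" if "e \<in> E" for e
  proof -
    have "{v \<in> V. v \<preceq> e} \<noteq> {}" "{f \<in> F. e \<preceq> f} \<noteq> {}"
      using edge_ends[OF that] by (metis card.empty zero_neq_numeral)+
    then show ?thesis using that by (auto simp: is_flag_def)
  qed
  have "x \<in> V \<or> x \<in> E \<or> x \<in> F" using rank_le_2[OF assms] assms by (auto simp: of_rank_def)
  then show thesis
  proof (elim disjE)
    assume "x \<in> V"
    then show thesis using ex_flag_vertex_face is_flagD(3)[OF \<Phi>] that by metis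
  next
    assume "x \<in> E"
    then show thesis using edge that by metis
  next
    assume x: "x \<in> F"
    then have "{e \<in> E. e \<preceq> x} \<noteq> {}" using face_edges[OF x] p_ge_2 by (metis card.empty not_numeral_le_zero)
    then obtain e where e: "e \<in> E" "e \<preceq> x" by blast
    then obtain v where "is_flag v e x" using edge[OF e(1)] x by (auto simp: is_flag_def)
    then show thesis using that by blast
  qed
qed

sublocale \<Gamma>: group \<Gamma> by (rule group_automorphism_group)

text \<open>Automorphisms commute with the adjacency maps, so agreement on \<open>\<Phi>\<close>
  spreads to all flags, and every element lies in a flag. The group thus acts freely on
  flags.\<close>

lemma aut_eqI:
  assumes g: "g \<in> carrier \<Gamma>" and h: "h \<in> carrier \<Gamma>" and eq: "g ` \<Phi> = h ` \<Phi>"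
  shows "g = h"
proof (rule automorphism_group_eqI[OF g h])
  have flags: "g ` \<Psi> = h ` \<Psi>" if "\<Psi> \<in> flags P" for \<Psi>
  proof -
    have "\<Psi> \<in> {\<Psi> \<in> flags P. g ` \<Psi> = h ` \<Psi>}"
    proof (rule flags_connected[OF _ _ that])
      fix i :: nat and \<Psi> assume i: "i \<le> 2" and "\<Psi> \<in> {\<Psi> \<in> flags P. g ` \<Psi> = h ` \<Psi>}"
      then have "\<Psi> \<in> flags P" "g ` \<Psi> = h ` \<Psi>" by simp_all
      then show "adj i \<Psi> \<in> {\<Psi> \<in> flags P. g ` \<Psi> = h ` \<Psi>}"
        using adj_flag[OF _ i] aut_adj[OF g _ i] aut_adj[OF h _ i] by simp
    qed (simp add: base_flag eq)
    then show ?thesis by simp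
  qed
  fix x assume "x \<in> elems P"
  then obtain v e f where fl: "is_flag v e f" "x = v \<or> x = e \<or> x = f" by (rule elem_in_flag)
  have "{g v, g e, g f} = {h v, h e, h f}" using flags[OF is_flag_in_flags[OF fl(1)]] by simp
  then show "g x = h x"
    using flag_eq_iff[OF aut_is_flag[OF g fl(1)] aut_is_flag[OF h fl(1)]] fl(2) by auto
qed

lemma aut_exists:
  assumes "\<Psi> \<in> flags P" obtains g where "g \<in> carrier \<Gamma>" "g ` \<Phi> = \<Psi>"
  using regular base_flag assms unfolding regular_def by blast

lemma card_aut: "card (carrier \<Gamma>) = 2 * p * q"
proof -
  have "bij_betw (\<lambda>g. g ` \<Phi>) (carrier \<Gamma>) (flags P)"
    unfolding bij_betw_def inj_on_def
  proof (intro conjI ballI impI)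
    show "(\<lambda>g. g ` \<Phi>) ` carrier \<Gamma> = flags P"
      using aut_flags base_flag by (auto elim: aut_exists)
  qed (rule aut_eqI)
  then show ?thesis using card_flags_eq bij_betw_same_card by metis
qed

abbreviation "\<rho> i \<equiv> rho P \<Phi> i"

text \<open>Regularity supplies a candidate for the definite description in \<open>rho\<close>, and
  \<open>aut_eqI\<close> its uniqueness.\<close>

lemma rho_closed: "i \<le> 2 \<Longrightarrow> \<rho> i \<in> carrier \<Gamma>"
  and rho_flag: "i \<le> 2 \<Longrightarrow> \<rho> i ` \<Phi> = adj i \<Phi>"
proof -
  assume "i \<le> 2"
  then obtain g where g: "g \<in> carrier \<Gamma>" "g ` \<Phi> = adj i \<Phi>"
    using aut_exists[OF adj_flag[OF base_flag]] by metis
  have "\<rho> i = g"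
    unfolding rho_def
  proof (rule the_equality)
    fix h assume h: "h \<in> carrier \<Gamma> \<and> h ` \<Phi> = adj i \<Phi>"
    show "h = g" by (rule aut_eqI) (simp_all only: g h)
  qed (simp only: g)
  then show "\<rho> i \<in> carrier \<Gamma>" "\<rho> i ` \<Phi> = adj i \<Phi>" using g by simp_all
qed

text \<open>Right multiplication by \<open>\<rho> i\<close> moves the image of the base flag to its
  neighbour of rank \<open>i\<close>, whatever \<open>g\<close> is, so products of generators read
  as walks in the flag graph.\<close>

lemma aut_rho_flag:
  assumes "g \<in> carrier \<Gamma>" "i \<le> 2" shows "(g \<otimes>\<^bsub>\<Gamma>\<^esub> \<rho> i) ` \<Phi> = adj i (g ` \<Phi>)"
  using assms by (simp add: aut_mult_image base_flag rho_closed rho_flag aut_adj)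

sublocale string_triple \<Gamma> "\<rho> 0" "\<rho> 1" "\<rho> 2"
proof unfold_locales
  have invol: "\<rho> i \<otimes>\<^bsub>\<Gamma>\<^esub> \<rho> i = \<one>\<^bsub>\<Gamma>\<^esub>" if "i \<le> 2" for i
    by (rule aut_eqI) (use that base_flag in \<open>simp_all add: rho_closed aut_rho_flag rho_flag adj_adj aut_one_image\<close>)
  then show "\<rho> 0 \<otimes>\<^bsub>\<Gamma>\<^esub> \<rho> 0 = \<one>\<^bsub>\<Gamma>\<^esub>" "\<rho> 1 \<otimes>\<^bsub>\<Gamma>\<^esub> \<rho> 1 = \<one>\<^bsub>\<Gamma>\<^esub>" "\<rho> 2 \<otimes>\<^bsub>\<Gamma>\<^esub> \<rho> 2 = \<one>\<^bsub>\<Gamma>\<^esub>" by simp_all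
  show "\<rho> 0 \<otimes>\<^bsub>\<Gamma>\<^esub> \<rho> 2 = \<rho> 2 \<otimes>\<^bsub>\<Gamma>\<^esub> \<rho> 0"
    by (rule aut_eqI) (simp_all add: rho_closed aut_rho_flag rho_flag adj_commute base_flag)
qed (simp_all add: rho_closed)

lemma rank_unique:
  assumes "\<Psi> \<in> flags P" "x \<in> \<Psi>" "y \<in> \<Psi>" "rank P x = rank P y" shows "x = y"
proof -
  obtain v e f where fl: "is_flag v e f" "\<Psi> = {v, e, f}" by (rule flags_E[OF assms(1)])
  then show ?thesis using is_flagD(10-12)[OF fl(1)] assms(2-4) by auto
qed

lemma aut_rank:
  assumes "g \<in> carrier \<Gamma>" "x \<in> elems P" shows "rank P (g x) = rank P x"
proof -
  obtain v e f where fl: "is_flag v e f" "x = v \<or> x = e \<or> x = f" by (rule elem_in_flag[OF assms(2)])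
  then show ?thesis using is_flagD(10-12)[OF fl(1)] is_flagD(10-12)[OF aut_is_flag[OF assms(1) fl(1)]] by auto
qed

lemma aut_fix:
  assumes "g \<in> carrier \<Gamma>" "x \<in> \<Phi>" "x \<in> g ` \<Phi>" shows "g x = x"
proof -
  obtain y where y: "y \<in> \<Phi>" "x = g y" using assms(3) by blast
  have "y = x"
    using rank_unique[OF base_flag y(1) assms(2)] aut_rank[OF assms(1)] y flags_subset_elems[OF base_flag] by auto
  then show ?thesis using y(2) by simp
qed

text \<open>Common core of the face and vertex cases. Closure of \<open>D\<close> under right
  multiplication makes the orbit closed under adjacency, so it contains all flags through
  \<open>x\<close>; conversely both generators fix \<open>x\<close>.\<close>

lemma orbit_eq_flags_containing:
  assumes x: "x \<in> \<Phi>" and i: "i \<le> 2" and adj_x: "x \<in> adj i \<Phi>" "x \<in> adj 1 \<Phi>"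
    and D: "D \<subseteq> generate \<Gamma> {\<rho> i, \<rho> 1}" "\<one>\<^bsub>\<Gamma>\<^esub> \<in> D"
    and D_mult: "\<And>g. g \<in> D \<Longrightarrow> g \<otimes>\<^bsub>\<Gamma>\<^esub> \<rho> i \<in> D" "\<And>g. g \<in> D \<Longrightarrow> g \<otimes>\<^bsub>\<Gamma>\<^esub> \<rho> 1 \<in> D"
    and connected: "\<And>T. (\<And>\<Psi>. \<Psi> \<in> T \<Longrightarrow> adj i \<Psi> \<in> T) \<Longrightarrow> (\<And>\<Psi>. \<Psi> \<in> T \<Longrightarrow> adj 1 \<Psi> \<in> T) \<Longrightarrow>
      \<Phi> \<in> T \<Longrightarrow> {\<Psi> \<in> flags P. x \<in> \<Psi>} \<subseteq> T"
  shows "(\<lambda>g. g ` \<Phi>) ` D = {\<Psi> \<in> flags P. x \<in> \<Psi>}"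
proof
  have gen_closed: "generate \<Gamma> {\<rho> i, \<rho> 1} \<subseteq> carrier \<Gamma>"
    by (rule \<Gamma>.generate_incl) (simp add: rho_closed i)
  then have D_closed: "g \<in> carrier \<Gamma>" if "g \<in> D" for g using that D(1) by blast
  show "{\<Psi> \<in> flags P. x \<in> \<Psi>} \<subseteq> (\<lambda>g. g ` \<Phi>) ` D"
  proof (rule connected)
    fix \<Psi> assume "\<Psi> \<in> (\<lambda>g. g ` \<Phi>) ` D"
    then obtain g where g: "g \<in> D" "\<Psi> = g ` \<Phi>" by blast
    have "adj i \<Psi> = (g \<otimes>\<^bsub>\<Gamma>\<^esub> \<rho> i) ` \<Phi>" "adj 1 \<Psi> = (g \<otimes>\<^bsub>\<Gamma>\<^esub> \<rho> 1) ` \<Phi>"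
      using aut_rho_flag[OF D_closed[OF g(1)]] i by (simp_all add: g(2))
    then show "adj i \<Psi> \<in> (\<lambda>g. g ` \<Phi>) ` D" "adj 1 \<Psi> \<in> (\<lambda>g. g ` \<Phi>) ` D"
      using D_mult[OF g(1)] by blast+
  next
    show "\<Phi> \<in> (\<lambda>g. g ` \<Phi>) ` D"
      using aut_one_image[OF base_flag] D(2) by (metis image_eqI)
  qed
  have x_elem: "x \<in> elems P" using x flags_subset_elems[OF base_flag] by blast
  have rho_x: "h x = x" if "h \<in> {\<rho> i, \<rho> 1}" for h
  proof (rule aut_fix[OF _ x])
    show "h \<in> carrier \<Gamma>" using that rho_closed i by auto
    show "x \<in> h ` \<Phi>" using that rho_flag[OF i] rho_flag[of 1] adj_x by auto
  qed
  have rho_inv: "inv\<^bsub>\<Gamma>\<^esub> \<rho> k = \<rho> k" if k: "k \<le> 2" for k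
  proof -
    consider "k = 0" | "k = 1" | "k = 2" using k by linarith
    then show ?thesis by cases simp_all
  qed
  have fixed: "g x = x" if "g \<in> generate \<Gamma> {\<rho> i, \<rho> 1}" for g
    using that
  proof (induction rule: generate.induct)
    case one
    show ?case by (rule automorphism_group_one[OF x_elem])
  next
    case (incl h)
    then show ?case by (rule rho_x)
  next
    case (inv h)
    then have "inv\<^bsub>\<Gamma>\<^esub> h = h" using rho_inv[OF i] rho_inv[of 1] by auto
    then show ?case using rho_x[OF inv] by simp
  next
    case (eng g h)
    then show ?case
      using automorphism_group_mult[OF subsetD[OF gen_closed eng.hyps(1)] subsetD[OF gen_closed eng.hyps(2)] x_elem]
      by simp
  qed
  have "x \<in> g ` \<Phi>" if "g \<in> D" for g
    using fixed[OF subsetD[OF D(1) that]] x by (intro image_eqI[of _ _ x]) simp_all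
  then show "(\<lambda>g. g ` \<Phi>) ` D \<subseteq> {\<Psi> \<in> flags P. x \<in> \<Psi>}"
    using aut_flags[OF D_closed base_flag] by blast
qed

lemma face_orbit:
  assumes "f \<in> F" "f \<in> \<Phi>"
  shows "(\<lambda>g. g ` \<Phi>) ` dihedral = {\<Psi> \<in> flags P. f \<in> \<Psi>}"
proof -
  obtain v e f' where fl: "is_flag v e f'" and \<Phi>: "\<Phi> = {v, e, f'}" by (rule flags_E[OF base_flag])
  have f': "f' = f" using assms is_flagD[OF fl] of_rankD(2)[OF assms(1)] \<Phi> by auto
  show ?thesis
  proof (rule orbit_eq_flags_containing[OF assms(2), of 0])
    show "f \<in> adj 0 \<Phi>" "f \<in> adj 1 \<Phi>"
      using is_flag_adj(1,2)[OF fl] by (auto simp: \<Phi> f')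
    fix T assume T: "\<And>\<Psi>. \<Psi> \<in> T \<Longrightarrow> adj 0 \<Psi> \<in> T" "\<And>\<Psi>. \<Psi> \<in> T \<Longrightarrow> adj 1 \<Psi> \<in> T" "\<Phi> \<in> T"
    show "{\<Psi> \<in> flags P. f \<in> \<Psi>} \<subseteq> T"
    proof
      fix \<Psi> assume "\<Psi> \<in> {\<Psi> \<in> flags P. f \<in> \<Psi>}"
      then have \<Psi>: "\<Psi> \<in> flags P" "f \<in> \<Psi>" by simp_all
      obtain w d h where wd: "is_flag w d h" "\<Psi> = {w, d, h}" by (rule flags_E[OF \<Psi>(1)])
      have "h = f" using \<Psi>(2) wd(2) is_flagD[OF wd(1)] of_rankD(2)[OF assms(1)] by auto
      then show "\<Psi> \<in> T"
        using flags_of_face_connected[of T v e f w d, OF T(1,2)] T(3) fl \<Phi> f' wd by simp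
    qed
  qed (simp_all add: dihedral_subset_generate one_in_dihedral dihedral_mult_r0 dihedral_mult_r1)
qed

sublocale swapped: string_triple \<Gamma> "\<rho> 2" "\<rho> 1" "\<rho> 0"
  by (rule swap)

lemma vertex_orbit:
  assumes "v \<in> V" "v \<in> \<Phi>"
  shows "(\<lambda>g. g ` \<Phi>) ` swapped.dihedral = {\<Psi> \<in> flags P. v \<in> \<Psi>}"
proof -
  obtain v' e f where fl: "is_flag v' e f" and \<Phi>: "\<Phi> = {v', e, f}" by (rule flags_E[OF base_flag])
  have v': "v' = v" using assms is_flagD[OF fl] of_rankD(2)[OF assms(1)] \<Phi> by auto
  show ?thesis
  proof (rule orbit_eq_flags_containing[OF assms(2), of 2])
    show "v \<in> adj 2 \<Phi>" "v \<in> adj 1 \<Phi>"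
      using is_flag_adj(2,3)[OF fl] by (auto simp: \<Phi> v')
    fix T assume T: "\<And>\<Psi>. \<Psi> \<in> T \<Longrightarrow> adj 2 \<Psi> \<in> T" "\<And>\<Psi>. \<Psi> \<in> T \<Longrightarrow> adj 1 \<Psi> \<in> T" "\<Phi> \<in> T"
    show "{\<Psi> \<in> flags P. v \<in> \<Psi>} \<subseteq> T"
    proof
      fix \<Psi> assume "\<Psi> \<in> {\<Psi> \<in> flags P. v \<in> \<Psi>}"
      then have \<Psi>: "\<Psi> \<in> flags P" "v \<in> \<Psi>" by simp_all
      obtain w d h where wd: "is_flag w d h" "\<Psi> = {w, d, h}" by (rule flags_E[OF \<Psi>(1)])
      have "w = v" using \<Psi>(2) wd(2) is_flagD[OF wd(1)] of_rankD(2)[OF assms(1)] by auto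
      then show "\<Psi> \<in> T"
        using flags_of_vertex_connected[of T v e f d h, OF T(2,1)] T(3) fl \<Phi> v' wd by simp
    qed
  qed (simp_all add: swapped.dihedral_subset_generate swapped.one_in_dihedral
      swapped.dihedral_mult_r0 swapped.dihedral_mult_r1)
qed

lemma inj_on_orbit: "D \<subseteq> carrier \<Gamma> \<Longrightarrow> inj_on (\<lambda>g. g ` \<Phi>) D"
  by (rule inj_onI) (rule aut_eqI; auto)

lemma dihedral_closed: "dihedral \<subseteq> carrier \<Gamma>" "swapped.dihedral \<subseteq> carrier \<Gamma>"
  by (auto elim!: dihedral_E swapped.dihedral_E)

lemma q_ge_2: "2 \<le> q"
proof -
  obtain v e f where "is_flag v e f" by (rule flags_E[OF base_flag])
  note F = is_flagD[OF this]
  have "card {e \<in> E. v \<preceq> e \<and> e \<preceq> f} \<le> card {e \<in> E. v \<preceq> e}"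
    by (rule card_mono) auto
  then show ?thesis using face_section(1)[OF F(3) F(1) F(6)] vertex_edges[OF F(1)] by simp
qed

text \<open>The two orbits have \<open>2 * p\<close> and \<open>2 * q\<close> flags and the action
  is free, so these are the sizes of the dihedral subgroups, and \<open>X_period\<close> applies to
  the triple and to its reversal.\<close>

lemma X_p: "X (int p) = \<one>\<^bsub>\<Gamma>\<^esub>" and Y_q: "Y (int q) = \<one>\<^bsub>\<Gamma>\<^esub>"
proof -
  obtain v e f where fl: "is_flag v e f" and \<Phi>: "\<Phi> = {v, e, f}" by (rule flags_E[OF base_flag])
  have "card ((\<lambda>g. g ` \<Phi>) ` dihedral) = 2 * p"
    using face_orbit[of f] card_flags_of_face[of f] is_flagD(3)[OF fl] \<Phi> by simp
  then have "card dihedral = 2 * p" using card_image[OF inj_on_orbit[OF dihedral_closed(1)]] by simp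
  then show "X (int p) = \<one>\<^bsub>\<Gamma>\<^esub>" using p_ge_2 by (rule X_period)
  have "card ((\<lambda>g. g ` \<Phi>) ` swapped.dihedral) = 2 * q"
    using vertex_orbit[of v] card_flags_of_vertex[of v] is_flagD(1)[OF fl] \<Phi> by simp
  then have "card swapped.dihedral = 2 * q" using card_image[OF inj_on_orbit[OF dihedral_closed(2)]] by simp
  then have "swapped.X (int q) = \<one>\<^bsub>\<Gamma>\<^esub>" using q_ge_2 by (rule swapped.X_period)
  then have "Y (- int q) = \<one>\<^bsub>\<Gamma>\<^esub>" by (simp only: X_swap)
  then show "Y (int q) = \<one>\<^bsub>\<Gamma>\<^esub>" using inv_Y[of "- int q"] by simp
qed

text \<open>The vertex \<open>g v\<close> lies on the base face, so some \<open>h\<close> in the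
  dihedral subgroup of that face takes \<open>v\<close> to \<open>g v\<close>. The inverse of
  \<open>h\<close> times \<open>g\<close> then fixes \<open>v\<close>, hence belongs to the dihedral
  subgroup of the base vertex.\<close>

lemma carrier_eq_NF: "carrier \<Gamma> = NF"
proof
  show "carrier \<Gamma> \<subseteq> NF"
  proof
    fix g assume g: "g \<in> carrier \<Gamma>"
    obtain v e f where fl: "is_flag v e f" and \<Phi>: "\<Phi> = {v, e, f}" by (rule flags_E[OF base_flag])
    have gfl: "is_flag (g v) (g e) (g f)" by (rule aut_is_flag[OF g fl])
    obtain d where d: "is_flag (g v) d f"
      using ex_flag_vertex_face[OF is_flagD(1)[OF gfl] is_flagD(3)[OF fl]] .
    then have "{g v, d, f} \<in> (\<lambda>g. g ` \<Phi>) ` dihedral"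
      using face_orbit[of f] is_flagD(3)[OF fl] is_flag_in_flags[OF d] \<Phi> by simp
    then obtain h where h: "h \<in> dihedral" "h ` \<Phi> = {g v, d, f}" by auto
    then have hc: "h \<in> carrier \<Gamma>" using dihedral_closed by blast
    have "h v = g v"
      using h(2) flag_eq_iff[OF aut_is_flag[OF hc fl] d] by (simp add: \<Phi>)
    have k: "inv\<^bsub>\<Gamma>\<^esub> h \<otimes>\<^bsub>\<Gamma>\<^esub> g \<in> carrier \<Gamma>" using g hc by simp
    have "(inv\<^bsub>\<Gamma>\<^esub> h \<otimes>\<^bsub>\<Gamma>\<^esub> g) v = (inv\<^bsub>\<Gamma>\<^esub> h) (h v)"
      using automorphism_group_mult[OF \<Gamma>.inv_closed[OF hc] g is_flagD(7)[OF fl]] \<open>h v = g v\<close> by simp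
    also have "\<dots> = (inv\<^bsub>\<Gamma>\<^esub> h \<otimes>\<^bsub>\<Gamma>\<^esub> h) v"
      using automorphism_group_mult[OF \<Gamma>.inv_closed[OF hc] hc is_flagD(7)[OF fl]] by simp
    also have "\<dots> = v"
      using automorphism_group_one[OF is_flagD(7)[OF fl]] hc by simp
    finally have "v \<in> (inv\<^bsub>\<Gamma>\<^esub> h \<otimes>\<^bsub>\<Gamma>\<^esub> g) ` \<Phi>" by (metis \<Phi> image_eqI insertI1)
    then have "(inv\<^bsub>\<Gamma>\<^esub> h \<otimes>\<^bsub>\<Gamma>\<^esub> g) ` \<Phi> \<in> (\<lambda>g. g ` \<Phi>) ` swapped.dihedral"
      using vertex_orbit[of v] is_flagD(1)[OF fl] aut_flags[OF k base_flag] \<Phi> by simp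
    then obtain h' where h': "h' \<in> swapped.dihedral" "(inv\<^bsub>\<Gamma>\<^esub> h \<otimes>\<^bsub>\<Gamma>\<^esub> g) ` \<Phi> = h' ` \<Phi>" by auto
    then have "inv\<^bsub>\<Gamma>\<^esub> h \<otimes>\<^bsub>\<Gamma>\<^esub> g = h'"
      using aut_eqI[OF k] dihedral_closed(2) by blast
    then have "g = h \<otimes>\<^bsub>\<Gamma>\<^esub> h'" using g hc by (simp add: \<Gamma>.m_assoc[symmetric] flip: \<open>inv\<^bsub>\<Gamma>\<^esub> h \<otimes>\<^bsub>\<Gamma>\<^esub> g = h'\<close>)
    then show "g \<in> NF" using dihedral_mult_NF[OF h(1) h'(1)] by simp
  qed
qed (rule NF_closed)

end

section \<open>Duality\<close>

lemma automorphism_group_dual: "automorphism_group (dual P) = automorphism_group P"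
proof -
  have "{g \<in> Bij (elems P). \<forall>x\<in>elems P. \<forall>y\<in>elems P. (x, y) \<in> (le P)\<inverse> \<longleftrightarrow> (g x, g y) \<in> (le P)\<inverse>} =
      {g \<in> Bij (elems P). \<forall>x\<in>elems P. \<forall>y\<in>elems P. (x, y) \<in> le P \<longleftrightarrow> (g x, g y) \<in> le P}"
    by auto
  then show ?thesis by (simp add: automorphism_group_def dual_def)
qed

lemma flags_dual: "flags (dual P) = flags P"
proof -
  have "Chains ((le P)\<inverse>) = Chains (le P)"
    unfolding Chains_def converse_iff by (simp only: disj_commute)
  then show ?thesis by (simp add: flags_def dual_def)
qed

lemma (in polyhedron_of_type) rho_dual:
  assumes "i \<le> 2" "\<Psi> \<in> flags P" shows "rho (dual P) \<Psi> i = rho P \<Psi> (2 - i)"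
proof -
  have restrict: "{x \<in> \<Psi>'. rank (dual P) x \<noteq> i} = {x \<in> \<Psi>'. rank P x \<noteq> 2 - i}" if "\<Psi>' \<in> flags P" for \<Psi>'
  proof (rule Collect_cong)
    fix x
    \<comment> \<open>Subtraction on natural numbers is truncated; the bound on the rank makes
      \<open>2 - rank P x = i\<close> equivalent to \<open>rank P x = 2 - i\<close>.\<close>
    have "rank P x \<le> 2" if "x \<in> \<Psi>'" using that rank_le_2 flags_subset_elems[OF \<open>\<Psi>' \<in> flags P\<close>] by blast
    then show "x \<in> \<Psi>' \<and> rank (dual P) x \<noteq> i \<longleftrightarrow> x \<in> \<Psi>' \<and> rank P x \<noteq> 2 - i"
      using assms(1) by (auto simp: dual_def)
  qed
  have "\<Psi>' \<in> flags (dual P) \<and> \<Psi>' \<noteq> \<Psi> \<and>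
        {x \<in> \<Psi>'. rank (dual P) x \<noteq> i} = {x \<in> \<Psi>. rank (dual P) x \<noteq> i} \<longleftrightarrow>
      \<Psi>' \<in> flags P \<and> \<Psi>' \<noteq> \<Psi> \<and> {x \<in> \<Psi>'. rank P x \<noteq> 2 - i} = {x \<in> \<Psi>. rank P x \<noteq> 2 - i}" for \<Psi>'
    unfolding flags_dual restrict[OF assms(2)] using restrict[of \<Psi>'] by (cases "\<Psi>' \<in> flags P") simp_all
  then have "adjacent_flag (dual P) \<Psi> i = adjacent_flag P \<Psi> (2 - i)"
    unfolding adjacent_flag_def by (simp only:)
  then show ?thesis by (simp add: rho_def automorphism_group_dual)
qed

theorem theorem3p6:
  fixes P :: "'a ranked_poset" and \<Phi> :: "'a set" and p q :: nat
  assumes "polyhedron P"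
    and "has_type P p q"
    and "tight P p q"
    and "\<Phi> \<in> flags P"
    and "non_orientably_regular P \<Phi>"
  shows "(\<exists>i j a b :: int.
            is_coxeter_quotient P \<Phi> p q (tight_relations p q i j a b)) \<or>
         (\<exists>i j a b :: int.
            is_coxeter_quotient (dual P) \<Phi> q p (tight_relations q p i j a b))"
proof -
  interpret tight_regular_polyhedron P p q \<Phi>
    using assms by unfold_locales (simp_all add: tight_def non_orientably_regular_def)
  have rotations: "generate \<Gamma> {X 1, Y 1} = carrier \<Gamma>"
    using assms(5) by (simp add: non_orientably_regular_def sigma1_def sigma2_def X_1 Y_1)
  have gen: "generate \<Gamma> {\<rho> 0, \<rho> 1, \<rho> 2} = carrier \<Gamma>"
  proof
    show "generate \<Gamma> {\<rho> 0, \<rho> 1, \<rho> 2} \<subseteq> carrier \<Gamma>" by (rule \<Gamma>.generate_incl) simp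
    \<comment> \<open>The three reflections generate \<Gamma> because the two rotations, which are
      products of them, already do by non-orientability.\<close>
    have "{X 1, Y 1} \<subseteq> generate \<Gamma> {\<rho> 0, \<rho> 1, \<rho> 2}"
      unfolding X_1 Y_1 by (auto intro!: generate.eng intro: generate.incl)
    then have "generate \<Gamma> {X 1, Y 1} \<subseteq> generate \<Gamma> {\<rho> 0, \<rho> 1, \<rho> 2}"
      by (rule \<Gamma>.generate_subgroup_incl) (rule \<Gamma>.generate_is_subgroup; simp)
    then show "carrier \<Gamma> \<subseteq> generate \<Gamma> {\<rho> 0, \<rho> 1, \<rho> 2}" by (simp only: rotations)
  qed
  have "0 < p" using p_ge_2 by simp
  from X_p this Y_q q_pos carrier_eq_NF card_aut rotations show ?thesis
  proof (rule tight_relations_exist)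
    fix i j a b
    assume "Y (- 1) \<otimes>\<^bsub>\<Gamma>\<^esub> X 1 = X i \<otimes>\<^bsub>\<Gamma>\<^esub> (\<rho> 1 \<otimes>\<^bsub>\<Gamma>\<^esub> Y j)" "Y (- 2) \<otimes>\<^bsub>\<Gamma>\<^esub> X 1 = X a \<otimes>\<^bsub>\<Gamma>\<^esub> Y b"
    from coxeter_quotient_iso[OF string_triple_axioms gen X_p \<open>0 < p\<close> Y_q q_pos card_aut this]
    have "is_coxeter_quotient P \<Phi> p q (tight_relations p q i j a b)"
      unfolding is_coxeter_quotient_def .
    then show ?thesis by blast
  next
    fix i j a b
    assume R: "X 1 \<otimes>\<^bsub>\<Gamma>\<^esub> Y (- 1) = Y (- i) \<otimes>\<^bsub>\<Gamma>\<^esub> (\<rho> 1 \<otimes>\<^bsub>\<Gamma>\<^esub> X (- j))" "X 2 \<otimes>\<^bsub>\<Gamma>\<^esub> Y (- 1) = Y (- a) \<otimes>\<^bsub>\<Gamma>\<^esub> X (- b)"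
    have gen': "generate \<Gamma> {\<rho> 2, \<rho> 1, \<rho> 0} = carrier \<Gamma>"
      using gen by (simp add: insert_commute)
    have period: "swapped.X (int q) = \<one>\<^bsub>\<Gamma>\<^esub>" "swapped.Y (int p) = \<one>\<^bsub>\<Gamma>\<^esub>"
      unfolding X_swap Y_swap using inv_X[of "int p"] inv_Y[of "int q"] by (simp_all add: X_p Y_q)
    have card': "card (carrier \<Gamma>) = 2 * q * p" by (simp add: card_aut)
    have R': "swapped.Y (- 1) \<otimes>\<^bsub>\<Gamma>\<^esub> swapped.X 1 = swapped.X i \<otimes>\<^bsub>\<Gamma>\<^esub> (\<rho> 1 \<otimes>\<^bsub>\<Gamma>\<^esub> swapped.Y j)"
      "swapped.Y (- 2) \<otimes>\<^bsub>\<Gamma>\<^esub> swapped.X 1 = swapped.X a \<otimes>\<^bsub>\<Gamma>\<^esub> swapped.Y b"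
      unfolding X_swap Y_swap using R by simp_all
    have "rho (dual P) \<Phi> 0 = \<rho> 2" "rho (dual P) \<Phi> 1 = \<rho> 1" "rho (dual P) \<Phi> 2 = \<rho> 0"
      using rho_dual[OF _ base_flag, of 0] rho_dual[OF _ base_flag, of 1] rho_dual[OF _ base_flag, of 2]
      by (simp_all add: One_nat_def)
    with coxeter_quotient_iso[OF swapped.string_triple_axioms gen' period(1) q_pos period(2) \<open>0 < p\<close> card' R']
    have "is_coxeter_quotient (dual P) \<Phi> q p (tight_relations q p i j a b)"
      unfolding is_coxeter_quotient_def automorphism_group_dual by simp
    then show ?thesis by blast
  qed
qed

end
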